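(* Let $k$ be a nonnegative integer and let $\mathcal K,\mathcal K',\mathcal E$ be Hilbert spaces. Let $\varphi\in B(\mathcal K,F^2(H_n)\otimes\mathcal K')$ and let $M_\theta\in B(F^2(H_n)\otimes\mathcal E,F^2(H_n)\otimes\mathcal K')$ be an inner multi-analytic operator. Then there exists $\psi\in B(\mathcal K,F^2(H_n)\otimes\mathcal E)$ such that $$\|M_\varphi-M_\theta M_\psi\|_{\mathcal P_k}\le1$$ if and only if the operator $A:=P_{\mathcal H}M_\varphi|_{\mathcal P_k\otimes\mathcal K}$ is a contraction, where the subspace $\mathcal H$ is defined by $$\mathcal H:=[F^2(H_n)\otimes\mathcal K']\ominus M_\theta[F^2(H_n)\otimes\mathcal E].$$
   Context: $H_n$ is an $n$-dimensional complex Hilbert space with orthonormal basis $e_1,\dots,e_n$, where $n\in\{1,2,\dots\}$ or $n=\infty$. The full Fock space is $F^2(H_n)=\bigoplus_{p\ge0}H_n^{\otimes p}$ with $H_n^{\otimes0}=\mathbb C1$; the left creation operators are $S_i\psi=e_i\otimes\psi$. $\mathbb F_n^+$ is the free monoid on generators $g_1,\dots,g_n$ with identity $g_0$; for $\alpha=g_{i_1}\cdots g_{i_p}$, $|\alpha|=p$, $e_\alpha=e_{i_1}\otimes\cdots\otimes e_{i_p}$ and $S_\alpha=S_{i_1}\cdots S_{i_p}$, with $|g_0|=0$, $e_{g_0}=1$, $S_{g_0}=I$. $\mathcal P_k=\bigoplus_{p=0}^kH_n^{\otimes p}$ is the space of polynomials of degree $\le k$ in $F^2(H_n)$. $P_{\mathcal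 H}$ is the orthogonal projection onto $\mathcal H$. For $\varphi\in B(\mathcal K,F^2(H_n)\otimes\mathcal K')$, $M_\varphi$ is the linear map (possibly unbounded, defined on polynomials with coefficients in $\mathcal K$) determined by $M_\varphi(1\otimes h)=\varphi h$ and $M_\varphi(S_i\otimes I_{\mathcal K})=(S_i\otimes I_{\mathcal K'})M_\varphi$, i.e. $M_\varphi(e_\alpha\otimes h)=(S_\alpha\otimes I_{\mathcal K'})\varphi h$; its restriction to each $\mathcal P_k\otimes\mathcal K$ is bounded. For such a map $M$ put $\|M\|_{\mathcal P_k}:=\sup\{\|Mq\|:q\in\mathcal P_k\otimes\mathcal K,\ \|q\|\le1\}$. A multi-analytic operator is a bounded operator $M\in B(F^2(H_n)\otimes\mathcal E,F^2(H_n)\otimes\mathcal K')$ with $M(S_i\otimes I_{\mathcal E})=(S_i\otimes I_{\mathcal K'})M$ for all $i$; its symbol is $\theta:\mathcal E\to F^2(H_n)\otimes\mathcal K'$, $\theta h=M(1\otimes h)$, and one writes $M=M_\theta$. (The set of these operators is $R_n^\infty\bar\otimes B(\mathcal E,\mathcal K')$, where $R_n^\infty$ is the weakly closed algebra generated by the identity and the right creation operators.) It is inner if it is an isometry. *)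

theory Defs
  imports "HOL-Analysis.Analysis"
begin

section \<open>Complex Hilbert spaces\<close>

class complex_hilbert_space = banach +
  fixes scaleC :: "complex \<Rightarrow> 'a \<Rightarrow> 'a" (infixr "*\<^sub>C" 75)
    and cinner :: "'a \<Rightarrow> 'a \<Rightarrow> complex"
  assumes scaleC_add_right: "c *\<^sub>C (x + y) = c *\<^sub>C x + c *\<^sub>C y"
    and scaleC_add_left: "(c + d) *\<^sub>C x = c *\<^sub>C x + d *\<^sub>C x"
    and scaleC_scaleC: "c *\<^sub>C d *\<^sub>C x = (c * d) *\<^sub>C x"
    and scaleR_eq_scaleC: "scaleR r x = complex_of_real r *\<^sub>C x"
    and cinner_commute: "cinner x y = cnj (cinner y x)"
    and cinner_add_left: "cinner (x + y) z = cinner x z + cinner y z"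
    and cinner_scaleC_left: "cinner (c *\<^sub>C x) y = c * cinner x y"
    and norm_eq_sqrt_cinner: "norm x = sqrt (Re (cinner x x))"

lemma scaleC_one [simp]: "1 *\<^sub>C (x::'a::complex_hilbert_space) = x"
  using scaleR_eq_scaleC[of 1 x] by simp

lemma scaleC_zero_left [simp]: "0 *\<^sub>C (x::'a::complex_hilbert_space) = 0"
  using scaleR_eq_scaleC[of 0 x] by simp

lemma scaleC_zero_right [simp]: "c *\<^sub>C (0::'a::complex_hilbert_space) = 0"
  using scaleC_add_right[of c 0 "0::'a"] by simp

lemma scaleC_minus_right: "c *\<^sub>C (- x) = - (c *\<^sub>C (x::'a::complex_hilbert_space))"
  using scaleC_add_right[of c x "- x"] by (simp add: eq_neg_iff_add_eq_0 add.commute)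

lemma scaleC_diff_right: "c *\<^sub>C (x - y) = c *\<^sub>C x - c *\<^sub>C (y::'a::complex_hilbert_space)"
  using scaleC_add_right[of c x "- y"] by (simp add: scaleC_minus_right)

lemma cinner_add_right: "cinner x (y + z) = cinner x y + cinner (x::'a::complex_hilbert_space) z"
  by (metis cinner_add_left cinner_commute complex_cnj_add)

lemma cinner_scaleC_right: "cinner x (c *\<^sub>C y) = cnj c * cinner (x::'a::complex_hilbert_space) y"
  by (metis cinner_commute cinner_scaleC_left complex_cnj_mult)

lemma cinner_zero_left [simp]: "cinner 0 (x::'a::complex_hilbert_space) = 0"
  using cinner_scaleC_left[of 0 0 x] by simp

lemma cinner_zero_right [simp]: "cinner (x::'a::complex_hilbert_space) 0 = 0"
  using cinner_scaleC_right[of x 0 0] by simp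

lemma cinner_minus_left: "cinner (- x) y = - cinner (x::'a::complex_hilbert_space) y"
  using cinner_add_left[of x "- x" y] by (simp add: eq_neg_iff_add_eq_0 add.commute)

lemma cinner_minus_right: "cinner x (- y) = - cinner (x::'a::complex_hilbert_space) y"
  using cinner_add_right[of x y "- y"] by (simp add: eq_neg_iff_add_eq_0 add.commute)

lemma cinner_diff_left: "cinner (x - y) z = cinner x z - cinner (y::'a::complex_hilbert_space) z"
  using cinner_add_left[of x "- y" z] by (simp add: cinner_minus_left)

lemma cinner_diff_right: "cinner x (y - z) = cinner x y - cinner (x::'a::complex_hilbert_space) z"
  using cinner_add_right[of x y "- z"] by (simp add: cinner_minus_right)

lemma Re_cinner_self: "Re (cinner x x) = (norm (x::'a::complex_hilbert_space))\<^sup>2"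
proof -
  have "0 \<le> Re (cinner x x)"
    using norm_ge_zero[of x] unfolding norm_eq_sqrt_cinner by simp
  then show ?thesis by (simp add: norm_eq_sqrt_cinner)
qed

lemma cinner_self: "cinner x x = complex_of_real ((norm (x::'a::complex_hilbert_space))\<^sup>2)"
proof (rule complex_eqI)
  have "Im (cinner x x) = - Im (cinner x x)"
    using cinner_commute[of x x] by (metis complex_cnj_cnj cnj.simps(2))
  then show "Im (cinner x x) = Im (complex_of_real ((norm x)\<^sup>2))" by simp
qed (simp add: Re_cinner_self)

lemma norm_add_sq:
  "(norm (x + y))\<^sup>2 = (norm x)\<^sup>2 + (norm y)\<^sup>2 + 2 * Re (cinner x (y::'a::complex_hilbert_space))"
proof -
  have "Re (cinner y x) = Re (cinner x y)" by (metis cinner_commute cnj.simps(1))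
  then show ?thesis
    by (simp add: Re_cinner_self[symmetric] cinner_add_left cinner_add_right)
qed

lemma norm_scaleC: "norm (c *\<^sub>C x) = cmod c * norm (x::'a::complex_hilbert_space)"
proof -
  have "cinner (c *\<^sub>C x) (c *\<^sub>C x) = (c * cnj c) * cinner x x"
    by (simp add: cinner_scaleC_left cinner_scaleC_right)
  also have "\<dots> = complex_of_real ((cmod c * norm x)\<^sup>2)"
    by (simp add: cinner_self complex_norm_square[symmetric] power_mult_distrib)
  finally have "(norm (c *\<^sub>C x))\<^sup>2 = (cmod c * norm x)\<^sup>2"
    by (metis Re_cinner_self Re_complex_of_real)
  then show ?thesis by simp
qed

lemma Cauchy_Schwarz: "cmod (cinner x y) \<le> norm x * norm (y::'a::complex_hilbert_space)"
proof (cases "cinner x y = 0")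
  case False
  define c where "c = cnj (sgn (cinner x y))"
  have c: "cmod c = 1" using False by (simp add: c_def norm_sgn)
  have "c * cinner x y = (cinner x y * cnj (cinner x y)) / complex_of_real (cmod (cinner x y))"
    by (simp add: c_def sgn_eq)
  also have "\<dots> = complex_of_real (cmod (cinner x y))"
    using False by (simp add: complex_norm_square[symmetric] power2_eq_square)
  finally have "c * cinner x y = complex_of_real (cmod (cinner x y))" .
  then have *: "Re (cinner (c *\<^sub>C x) y) = cmod (cinner x y)"
    by (simp add: cinner_scaleC_left)
  have "(norm (c *\<^sub>C x + y))\<^sup>2 \<le> (norm (c *\<^sub>C x) + norm y)\<^sup>2"
    by (intro power_mono norm_triangle_ineq) simp
  then show ?thesis
    unfolding norm_add_sq * by (simp add: norm_scaleC c power2_eq_square algebra_simps)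
qed simp

instantiation complex :: complex_hilbert_space
begin
definition "scaleC_complex = ((*) :: complex \<Rightarrow> complex \<Rightarrow> complex)"
definition "cinner_complex (x::complex) y = x * cnj y"
instance
  by standard (auto simp: scaleC_complex_def cinner_complex_def algebra_simps scaleR_conv_of_real
      cmod_def power2_eq_square)
end

definition bounded_clinear :: "('a::complex_hilbert_space \<Rightarrow> 'b::complex_hilbert_space) \<Rightarrow> bool" where
  "bounded_clinear T \<longleftrightarrow> bounded_linear T \<and> (\<forall>c x. T (c *\<^sub>C x) = c *\<^sub>C T x)"

definition ortho_compl :: "'a::complex_hilbert_space set \<Rightarrow> 'a set" where
  "ortho_compl S = {x. \<forall>y\<in>S. cinner x y = 0}"

definition ortho_proj :: "'a::complex_hilbert_space set \<Rightarrow> 'a \<Rightarrow> 'a" where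
  "ortho_proj H x = (THE y. y \<in> H \<and> x - y \<in> ortho_compl H)"

definition contraction_on :: "'a::real_normed_vector set \<Rightarrow> ('a \<Rightarrow> 'b::real_normed_vector) \<Rightarrow> bool" where
  "contraction_on S T \<longleftrightarrow> (\<forall>x\<in>S. norm (T x) \<le> norm x)"

lemma ortho_compl_add: "x \<in> ortho_compl S \<Longrightarrow> y \<in> ortho_compl S \<Longrightarrow> x + y \<in> ortho_compl S"
  by (simp add: ortho_compl_def cinner_add_left)

lemma ortho_compl_diff: "x \<in> ortho_compl S \<Longrightarrow> y \<in> ortho_compl S \<Longrightarrow> x - y \<in> ortho_compl S"
  by (simp add: ortho_compl_def cinner_diff_left)

lemma ortho_compl_scaleC: "x \<in> ortho_compl S \<Longrightarrow> c *\<^sub>C x \<in> ortho_compl S"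
  by (simp add: ortho_compl_def cinner_scaleC_left)

lemma bounded_linear_cinner_left: "bounded_linear (\<lambda>x. cinner x (y::'a::complex_hilbert_space))"
proof (rule bounded_linear_intro[where K = "norm y"])
  show "cinner (r *\<^sub>R x) y = r *\<^sub>R cinner x y" for r x
    by (simp add: scaleR_eq_scaleC[of r x] cinner_scaleC_left scaleR_conv_of_real)
qed (auto simp: cinner_add_left Cauchy_Schwarz)

lemma closed_ortho_compl: "closed (ortho_compl S)"
proof -
  have "ortho_compl S = (\<Inter>y\<in>S. (\<lambda>x. cinner x y) -` {0})"
    by (auto simp: ortho_compl_def)
  then show ?thesis
    by (auto intro!: closed_INT closed_vimage
        intro: linear_continuous_on bounded_linear_cinner_left)
qed

lemma parallelogram:
  "(norm (x - y))\<^sup>2 + (norm (x + y))\<^sup>2 = 2 * (norm x)\<^sup>2 + 2 * (norm (y::'a::complex_hilbert_space))\<^sup>2"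
  using norm_add_sq[of x y] norm_add_sq[of x "- y"] by (simp add: cinner_minus_right)

lemma zero_in_ortho_compl: "0 \<in> ortho_compl S"
  by (simp add: ortho_compl_def)

theorem ortho_proj_ex1:
  fixes H :: "'a::complex_hilbert_space set"
  assumes "0 \<in> H" and add: "\<And>x y. x \<in> H \<Longrightarrow> y \<in> H \<Longrightarrow> x + y \<in> H"
    and scale: "\<And>c x. x \<in> H \<Longrightarrow> c *\<^sub>C x \<in> H" and "closed H"
  shows "\<exists>!y. y \<in> H \<and> x - y \<in> ortho_compl H"
proof -
  define D where "D = (\<lambda>y. (norm (x - y))\<^sup>2) ` H"
  define d where "d = Inf D"
  have "D \<noteq> {}" using \<open>0 \<in> H\<close> by (auto simp: D_def)
  have "bdd_below D" by (auto simp: D_def intro!: bdd_belowI[where m = 0])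
  have dle: "d \<le> (norm (x - y))\<^sup>2" if "y \<in> H" for y
    unfolding d_def using \<open>bdd_below D\<close> that by (auto simp: D_def intro!: cInf_lower)
  have "\<exists>y\<in>H. (norm (x - y))\<^sup>2 < d + inverse (Suc n)" for n
  proof -
    have "Inf D < d + inverse (Suc n)" by (simp add: d_def)
    then show ?thesis
      using cInf_lessD[OF \<open>D \<noteq> {}\<close>] by (force simp: D_def)
  qed
  then obtain y where yH: "\<And>n. y n \<in> H"
    and yd: "\<And>n. (norm (x - y n))\<^sup>2 < d + inverse (Suc n)" by metis
  have yy: "(norm (y m - y n))\<^sup>2 < 2 * inverse (Suc m) + 2 * inverse (Suc n)" for m n
  proof -
    define z where "z = complex_of_real (1/2) *\<^sub>C (y m + y n)"
    have "z \<in> H" by (simp add: z_def yH add scale)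
    have "2 *\<^sub>R z = y m + y n"
      by (simp add: z_def scaleR_eq_scaleC scaleC_scaleC flip: of_real_mult)
    then have "(x - y m) + (x - y n) = 2 *\<^sub>R (x - z)"
      by (simp add: algebra_simps scaleR_2)
    then have "(norm ((x - y m) + (x - y n)))\<^sup>2 = 4 * (norm (x - z))\<^sup>2"
      by (simp add: power_mult_distrib)
    moreover have "norm ((x - y m) - (x - y n)) = norm (y m - y n)"
      by (simp add: norm_minus_commute)
    ultimately have "(norm (y m - y n))\<^sup>2 + 4 * (norm (x - z))\<^sup>2
        = 2 * (norm (x - y m))\<^sup>2 + 2 * (norm (x - y n))\<^sup>2"
      using parallelogram[of "x - y m" "x - y n"] by simp
    then show ?thesis using dle[OF \<open>z \<in> H\<close>] yd[of m] yd[of n] by linarith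
  qed
  have "Cauchy y"
  proof (rule metric_CauchyI)
    fix e :: real assume "e > 0"
    then have "e\<^sup>2 / 4 > 0" by simp
    then obtain N where N: "inverse (Suc N) < e\<^sup>2 / 4" using reals_Archimedean by blast
    have "dist (y m) (y n) < e" if "m \<ge> N" "n \<ge> N" for m n
    proof -
      have "inverse (Suc m) \<le> inverse (real (Suc N))" "inverse (Suc n) \<le> inverse (real (Suc N))"
        using that by (simp_all add: le_imp_inverse_le)
      then have "(norm (y m - y n))\<^sup>2 < e\<^sup>2" using yy[of m n] N by linarith
      then show ?thesis using \<open>e > 0\<close> by (simp add: dist_norm power_less_imp_less_base)
    qed
    then show "\<exists>M. \<forall>m\<ge>M. \<forall>n\<ge>M. dist (y m) (y n) < e" by blast
  qed
  then obtain p where p: "y \<longlonglongrightarrow> p" using Cauchy_convergent convergent_def by blast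
  have "p \<in> H" using closed_sequentially[OF \<open>closed H\<close>] yH p by blast
  have "(norm (x - p))\<^sup>2 \<le> d + 0"
  proof (rule LIMSEQ_le)
    show "(\<lambda>n. (norm (x - y n))\<^sup>2) \<longlonglongrightarrow> (norm (x - p))\<^sup>2" by (intro tendsto_intros p)
    show "(\<lambda>n. d + inverse (Suc n)) \<longlonglongrightarrow> d + 0"
      by (intro tendsto_intros LIMSEQ_inverse_real_of_nat)
    show "\<exists>N. \<forall>n\<ge>N. (norm (x - y n))\<^sup>2 \<le> d + inverse (Suc n)"
      using yd by (auto intro!: exI[of _ 0] less_imp_le)
  qed
  then have pd: "(norm (x - p))\<^sup>2 \<le> (norm (x - z))\<^sup>2" if "z \<in> H" for z
    using dle[OF that] by linarith
  have "x - p \<in> ortho_compl H"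
    unfolding ortho_compl_def
  proof safe
    fix z assume "z \<in> H"
    show "cinner (x - p) z = 0"
    proof (cases "z = 0")
      case False
      define a where "a = cinner (x - p) z"
      define c where "c = a / complex_of_real ((norm z)\<^sup>2)"
      have "p + c *\<^sub>C z \<in> H" using add scale \<open>p \<in> H\<close> \<open>z \<in> H\<close> by blast
      then have "(norm (x - p))\<^sup>2 \<le> (norm ((x - p) + - (c *\<^sub>C z)))\<^sup>2"
        using pd[of "p + c *\<^sub>C z"] by (simp add: algebra_simps)
      also have "\<dots> = (norm (x - p))\<^sup>2 + (norm (c *\<^sub>C z))\<^sup>2 - 2 * Re (cnj c * a)"
        by (simp only: norm_add_sq cinner_minus_right cinner_scaleC_right a_def norm_minus_cancel) simp
      also have "cnj c * a = complex_of_real ((cmod a)\<^sup>2 / (norm z)\<^sup>2)"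
        by (simp add: c_def complex_norm_square[symmetric] mult.commute[of "cnj a"])
      also have "(norm (c *\<^sub>C z))\<^sup>2 = (cmod a)\<^sup>2 / (norm z)\<^sup>2"
        using False by (simp add: norm_scaleC c_def norm_divide power2_eq_square field_simps norm_mult)
      finally have "(cmod a)\<^sup>2 / (norm z)\<^sup>2 \<le> 0" by simp
      then have "a = 0" using False by (simp add: divide_le_0_iff)
      then show ?thesis by (simp add: a_def)
    qed simp
  qed
  moreover have "q = p" if "q \<in> H" "x - q \<in> ortho_compl H" for q
  proof -
    have "(-1) *\<^sub>C p = - p"
      using scaleC_add_left[of "-1" 1 p] by (simp add: eq_neg_iff_add_eq_0)
    then have "q - p \<in> H"
      using add[OF \<open>q \<in> H\<close> scale[OF \<open>p \<in> H\<close>, of "-1"]] by simp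
    moreover have "q - p \<in> ortho_compl H"
      using ortho_compl_diff[OF \<open>x - p \<in> ortho_compl H\<close> that(2)] by simp
    ultimately have "cinner (q - p) (q - p) = 0" by (auto simp: ortho_compl_def)
    then show ?thesis using Re_cinner_self[of "q - p"] by simp
  qed
  ultimately show ?thesis using \<open>p \<in> H\<close> by blast
qed

corollary ortho_proj_ortho_compl:
  "ortho_proj (ortho_compl S) x \<in> ortho_compl S \<and>
    x - ortho_proj (ortho_compl S) x \<in> ortho_compl (ortho_compl S)"
  unfolding ortho_proj_def
  by (rule theI', rule ortho_proj_ex1)
    (auto intro: ortho_compl_add ortho_compl_scaleC closed_ortho_compl zero_in_ortho_compl)


section \<open>The full Fock space with coefficients\<close>

text \<open>
  The type \<open>'i\<close> indexes the orthonormal basis of \<open>H\<^sub>n\<close>, so a countable type covers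
  \<open>n = 1, 2, \<dots>, \<infinity>\<close>. Lists over \<open>'i\<close> are the free monoid on the generators, \<open>[]\<close> being its
  identity. The vectors \<open>e\<^sub>\<alpha>\<close> with \<open>length \<alpha> = p\<close> form an orthonormal basis of the \<open>p\<close>-th
  tensor power of \<open>H\<^sub>n\<close>, so that the elements of \<open>F\<^sup>2(H\<^sub>n) \<otimes> K\<close> are uniquely
  \<open>\<Sum>\<alpha>. e\<^sub>\<alpha> \<otimes> x\<^sub>\<alpha>\<close> with a square summable family of \<open>x\<^sub>\<alpha> \<in> K\<close>; \<open>F\<^sup>2(H\<^sub>n)\<close> itself is the
  case \<open>K = \<complex>\<close>.
\<close>

typedef (overloaded) ('i, 'a) fock =
  "{f :: 'i list \<Rightarrow> 'a::complex_hilbert_space. (\<lambda>\<alpha>. (norm (f \<alpha>))\<^sup>2) summable_on UNIV}"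
  morphisms coeff Abs_fock
  by (intro exI[of _ "\<lambda>_. 0"]) simp

setup_lifting type_definition_fock

lemma fock_eqI: "(\<And>\<alpha>. coeff f \<alpha> = coeff g \<alpha>) \<Longrightarrow> f = g"
  by (metis coeff_inject ext)

lemma summable_coeff: "(\<lambda>\<alpha>. (norm (coeff f \<alpha>))\<^sup>2) summable_on A"
  using coeff[of f] by (auto intro: summable_on_subset_banach)

lemma sq_summable_add:
  fixes f g :: "'b \<Rightarrow> 'a::real_normed_vector"
  assumes "(\<lambda>x. (norm (f x))\<^sup>2) summable_on A" "(\<lambda>x. (norm (g x))\<^sup>2) summable_on A"
  shows "(\<lambda>x. (norm (f x + g x))\<^sup>2) summable_on A"
proof (rule summable_on_comparison_test)
  show "(\<lambda>x. 2 * (norm (f x))\<^sup>2 + 2 * (norm (g x))\<^sup>2) summable_on A"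
    using assms by (intro summable_on_add summable_on_cmult_right)
  show "(norm (f x + g x))\<^sup>2 \<le> 2 * (norm (f x))\<^sup>2 + 2 * (norm (g x))\<^sup>2" for x
  proof -
    have "(norm (f x + g x))\<^sup>2 \<le> (norm (f x) + norm (g x))\<^sup>2"
      by (intro power_mono norm_triangle_ineq) simp
    also have "\<dots> \<le> 2 * (norm (f x))\<^sup>2 + 2 * (norm (g x))\<^sup>2"
      using sum_squares_bound[of "norm (f x)" "norm (g x)"] by (simp add: power2_eq_square algebra_simps)
    finally show ?thesis .
  qed
qed simp

lemma sq_summable_scaleC:
  fixes f :: "'b \<Rightarrow> 'a::complex_hilbert_space"
  assumes "(\<lambda>x. (norm (f x))\<^sup>2) summable_on A"
  shows "(\<lambda>x. (norm (c *\<^sub>C f x))\<^sup>2) summable_on A"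
  using summable_on_cmult_right[OF assms, of "(cmod c)\<^sup>2"] by (simp add: norm_scaleC power_mult_distrib)

lemma summable_cinner:
  fixes f g :: "'b \<Rightarrow> 'a::complex_hilbert_space"
  assumes f: "(\<lambda>x. (norm (f x))\<^sup>2) summable_on A" and g: "(\<lambda>x. (norm (g x))\<^sup>2) summable_on A"
  shows "(\<lambda>x. cinner (f x) (g x)) summable_on A"
proof -
  have "(\<lambda>x. norm (cinner (f x) (g x))) summable_on A"
  proof (rule summable_on_comparison_test)
    show "(\<lambda>x. (norm (f x))\<^sup>2 + (norm (g x))\<^sup>2) summable_on A"
      using f g by (rule summable_on_add)
    show "norm (cinner (f x) (g x)) \<le> (norm (f x))\<^sup>2 + (norm (g x))\<^sup>2" for x
    proof -
      have "0 \<le> norm (f x) * norm (g x)" by simp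
      then show ?thesis
        using Cauchy_Schwarz[of "f x" "g x"] sum_squares_bound[of "norm (f x)" "norm (g x)"]
        by linarith
    qed
  qed simp
  then show ?thesis by (rule abs_summable_summable)
qed

instantiation fock :: (type, complex_hilbert_space) real_normed_vector
begin

lift_definition zero_fock :: "('a, 'b) fock" is "\<lambda>_. 0" by simp

lift_definition plus_fock :: "('a, 'b) fock \<Rightarrow> ('a, 'b) fock \<Rightarrow> ('a, 'b) fock"
  is "\<lambda>f g \<alpha>. f \<alpha> + g \<alpha>" by (rule sq_summable_add)

lift_definition uminus_fock :: "('a, 'b) fock \<Rightarrow> ('a, 'b) fock" is "\<lambda>f \<alpha>. - f \<alpha>" by simp

lift_definition minus_fock :: "('a, 'b) fock \<Rightarrow> ('a, 'b) fock \<Rightarrow> ('a, 'b) fock"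
  is "\<lambda>f g \<alpha>. f \<alpha> - g \<alpha>"
proof -
  fix f g :: "'a list \<Rightarrow> 'b"
  assume "(\<lambda>\<alpha>. (norm (f \<alpha>))\<^sup>2) summable_on UNIV" "(\<lambda>\<alpha>. (norm (g \<alpha>))\<^sup>2) summable_on UNIV"
  then show "(\<lambda>\<alpha>. (norm (f \<alpha> - g \<alpha>))\<^sup>2) summable_on UNIV"
    using sq_summable_add[of f UNIV "\<lambda>\<alpha>. - g \<alpha>"] by simp
qed

lift_definition scaleR_fock :: "real \<Rightarrow> ('a, 'b) fock \<Rightarrow> ('a, 'b) fock"
  is "\<lambda>r f \<alpha>. r *\<^sub>R f \<alpha>"
  unfolding scaleR_eq_scaleC by (rule sq_summable_scaleC)

definition norm_fock :: "('a, 'b) fock \<Rightarrow> real"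
  where "norm_fock f = sqrt (\<Sum>\<^sub>\<infinity>\<alpha>. (norm (coeff f \<alpha>))\<^sup>2)"

definition dist_fock :: "('a, 'b) fock \<Rightarrow> ('a, 'b) fock \<Rightarrow> real"
  where "dist_fock f g = norm (f - g)"

definition sgn_fock :: "('a, 'b) fock \<Rightarrow> ('a, 'b) fock"
  where "sgn_fock f = inverse (norm f) *\<^sub>R f"

definition uniformity_fock :: "(('a, 'b) fock \<times> ('a, 'b) fock) filter"
  where "uniformity_fock = (INF e\<in>{0 <..}. principal {(x, y). dist x y < e})"

definition open_fock :: "('a, 'b) fock set \<Rightarrow> bool"
  where "open_fock S = (\<forall>x\<in>S. \<forall>\<^sub>F (x', y) in uniformity. x' = x \<longrightarrow> y \<in> S)"

lemma norm_fock_L2_set: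
  "finite F \<Longrightarrow> L2_set (\<lambda>\<alpha>. norm (coeff f \<alpha>)) F \<le> norm (f::('a, 'b) fock)"
  unfolding L2_set_def norm_fock_def
  by (intro real_sqrt_le_mono finite_sum_le_infsum summable_coeff) auto

lemma norm_fock_le:
  assumes "\<And>F. finite F \<Longrightarrow> L2_set (\<lambda>\<alpha>. norm (coeff f \<alpha>)) F \<le> B"
  shows "norm (f::('a, 'b) fock) \<le> B"
proof -
  have "B \<ge> 0" using assms[of "{}"] by simp
  moreover have "(\<Sum>\<^sub>\<infinity>\<alpha>. (norm (coeff f \<alpha>))\<^sup>2) \<le> B\<^sup>2"
  proof (rule infsum_le_finite_sums)
    fix F :: "'a list set" assume "finite F"
    then have "sqrt (\<Sum>\<alpha>\<in>F. (norm (coeff f \<alpha>))\<^sup>2) \<le> B" using assms[of F] by (simp add: L2_set_def)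
    then show "(\<Sum>\<alpha>\<in>F. (norm (coeff f \<alpha>))\<^sup>2) \<le> B\<^sup>2"
      by (simp add: sqrt_le_D)
  qed (rule summable_coeff)
  ultimately show ?thesis unfolding norm_fock_def by (simp add: real_le_lsqrt real_sqrt_le_iff)
qed

lemma norm_fock_triangle: "norm (f + g) \<le> norm f + norm (g::('a, 'b) fock)"
proof (rule norm_fock_le)
  fix F :: "'a list set" assume F: "finite F"
  have "L2_set (\<lambda>\<alpha>. norm (coeff (f + g) \<alpha>)) F \<le> L2_set (\<lambda>\<alpha>. norm (coeff f \<alpha>) + norm (coeff g \<alpha>)) F"
    by (rule L2_set_mono) (auto simp: plus_fock.rep_eq norm_triangle_ineq)
  also have "\<dots> \<le> L2_set (\<lambda>\<alpha>. norm (coeff f \<alpha>)) F + L2_set (\<lambda>\<alpha>. norm (coeff g \<alpha>)) F"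
    by (rule L2_set_triangle_ineq)
  also have "\<dots> \<le> norm f + norm g"
    by (intro add_mono norm_fock_L2_set F)
  finally show "L2_set (\<lambda>\<alpha>. norm (coeff (f + g) \<alpha>)) F \<le> norm f + norm g" .
qed

lemma norm_coeff_le: "norm (coeff f \<alpha>) \<le> norm (f::('a, 'b) fock)"
  using norm_fock_L2_set[of "{\<alpha>}" f] by simp

lemma norm_fock_eq_0: "norm f = 0 \<longleftrightarrow> f = (0::('a, 'b) fock)"
proof
  assume "norm f = 0"
  then show "f = 0"
    using norm_coeff_le[of f] by (intro fock_eqI) (simp add: zero_fock.rep_eq)
qed (simp add: norm_fock_def zero_fock.rep_eq)

lemma norm_fock_minus_commute: "norm (f - g) = norm (g - (f::('a, 'b) fock))"
  by (simp add: norm_fock_def minus_fock.rep_eq norm_minus_commute)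

lemma fock_minus_eq_0: "f - g = 0 \<longleftrightarrow> f = (g::('a, 'b) fock)"
  by (auto simp: coeff_inject[symmetric] minus_fock.rep_eq zero_fock.rep_eq fun_eq_iff)

instance
proof
  fix f g :: "('a, 'b) fock" and r :: real
  show "uniformity = (INF e\<in>{0<..}. principal {(x, y). dist x (y::('a, 'b) fock) < e})"
    by (rule uniformity_fock_def)
  show "open U = (\<forall>x\<in>U. \<forall>\<^sub>F (x', y) in uniformity. x' = x \<longrightarrow> y \<in> U)" for U :: "('a, 'b) fock set"
    by (rule open_fock_def)
  show "dist f g = norm (f - g)" by (rule dist_fock_def)
  show "sgn f = inverse (norm f) *\<^sub>R f" by (rule sgn_fock_def)
  show "norm f = 0 \<longleftrightarrow> f = 0" by (rule norm_fock_eq_0)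
  show "norm (f + g) \<le> norm f + norm g" by (rule norm_fock_triangle)
  show "norm (r *\<^sub>R f) = \<bar>r\<bar> * norm f"
    by (simp add: norm_fock_def scaleR_fock.rep_eq power_mult_distrib infsum_cmult_right'
        real_sqrt_mult)
qed (auto intro!: fock_eqI simp: plus_fock.rep_eq minus_fock.rep_eq uminus_fock.rep_eq
    zero_fock.rep_eq scaleR_fock.rep_eq algebra_simps)

end

lemma fock_Cauchy_convergent:
  fixes X :: "nat \<Rightarrow> ('a, 'b::complex_hilbert_space) fock"
  assumes X: "\<And>e. e > 0 \<Longrightarrow> \<exists>M. \<forall>m\<ge>M. \<forall>n\<ge>M. norm (X m - X n) < e"
  shows "\<exists>L. \<forall>e>0. \<exists>M. \<forall>n\<ge>M. norm (X n - L) \<le> e"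
proof -
  have "Cauchy (\<lambda>n. coeff (X n) \<alpha>)" for \<alpha>
  proof (rule metric_CauchyI)
    fix e :: real assume "e > 0"
    then obtain M where M: "\<And>m n. m \<ge> M \<Longrightarrow> n \<ge> M \<Longrightarrow> norm (X m - X n) < e" using X by blast
    have "dist (coeff (X m) \<alpha>) (coeff (X n) \<alpha>) < e" if "m \<ge> M" "n \<ge> M" for m n
      using norm_coeff_le[of "X m - X n" \<alpha>] M[OF that] by (simp add: dist_norm minus_fock.rep_eq)
    then show "\<exists>M. \<forall>m\<ge>M. \<forall>n\<ge>M. dist (coeff (X m) \<alpha>) (coeff (X n) \<alpha>) < e" by blast
  qed
  then have "\<forall>\<alpha>. \<exists>l. (\<lambda>n. coeff (X n) \<alpha>) \<longlonglongrightarrow> l" using Cauchy_convergent convergent_def by blast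
  then obtain l where l: "\<And>\<alpha>. (\<lambda>n. coeff (X n) \<alpha>) \<longlonglongrightarrow> l \<alpha>" by metis
  have bound: "L2_set (\<lambda>\<alpha>. norm (coeff (X n) \<alpha> - l \<alpha>)) F \<le> e"
    if M: "\<And>m n. m \<ge> M \<Longrightarrow> n \<ge> M \<Longrightarrow> norm (X m - X n) < e" and "n \<ge> M" "finite F" for M n F e
  proof (rule tendsto_upperbound)
    show "(\<lambda>m. L2_set (\<lambda>\<alpha>. norm (coeff (X n) \<alpha> - coeff (X m) \<alpha>)) F)
        \<longlonglongrightarrow> L2_set (\<lambda>\<alpha>. norm (coeff (X n) \<alpha> - l \<alpha>)) F"
      unfolding L2_set_def by (intro tendsto_intros l)
    show "\<forall>\<^sub>F m in sequentially. L2_set (\<lambda>\<alpha>. norm (coeff (X n) \<alpha> - coeff (X m) \<alpha>)) F \<le> e"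
    proof (rule eventually_sequentiallyI)
      fix m assume "m \<ge> M"
      show "L2_set (\<lambda>\<alpha>. norm (coeff (X n) \<alpha> - coeff (X m) \<alpha>)) F \<le> e"
        using norm_fock_L2_set[OF \<open>finite F\<close>, of "X n - X m"] M[OF \<open>n \<ge> M\<close> \<open>m \<ge> M\<close>]
        by (simp add: minus_fock.rep_eq)
    qed
  qed simp
  obtain M where M: "\<And>m n. m \<ge> M \<Longrightarrow> n \<ge> M \<Longrightarrow> norm (X m - X n) < 1"
    using X[of 1] by auto
  have "(\<lambda>\<alpha>. (norm (coeff (X M) \<alpha> - l \<alpha>))\<^sup>2) summable_on UNIV"
  proof (rule nonneg_bdd_above_summable_on)
    show "bdd_above (sum (\<lambda>\<alpha>. (norm (coeff (X M) \<alpha> - l \<alpha>))\<^sup>2) ` {F. F \<subseteq> UNIV \<and> finite F})"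
      using bound[OF M order_refl] by (auto simp: L2_set_def intro!: bdd_aboveI[where M = 1])
  qed simp
  then have *: "(\<lambda>\<alpha>. (norm (l \<alpha> - coeff (X M) \<alpha>))\<^sup>2) summable_on UNIV"
    by (simp add: norm_minus_commute)
  have "(\<lambda>\<alpha>. (norm (l \<alpha>))\<^sup>2) summable_on UNIV"
    using sq_summable_add[OF * summable_coeff[of "X M"]] by simp
  then have L: "coeff (Abs_fock l) = l" by (simp add: Abs_fock_inverse)
  have "\<exists>M. \<forall>n\<ge>M. norm (X n - Abs_fock l) \<le> e" if "e > 0" for e
  proof -
    obtain M where M: "\<And>m n. m \<ge> M \<Longrightarrow> n \<ge> M \<Longrightarrow> norm (X m - X n) < e" using X[OF \<open>e > 0\<close>] by blast
    have "norm (X n - Abs_fock l) \<le> e" if "n \<ge> M" for n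
      by (rule norm_fock_le) (use bound[OF M that] in \<open>simp add: minus_fock.rep_eq L\<close>)
    then show ?thesis by blast
  qed
  then show ?thesis by blast
qed

instance fock :: (type, complex_hilbert_space) banach
proof
  fix X :: "nat \<Rightarrow> ('a, 'b) fock"
  assume "Cauchy X"
  then have "\<exists>M. \<forall>m\<ge>M. \<forall>n\<ge>M. norm (X m - X n) < e" if "e > 0" for e
    using that CauchyD by blast
  from fock_Cauchy_convergent[OF this]
  obtain L where L: "\<And>e. e > 0 \<Longrightarrow> \<exists>M. \<forall>n\<ge>M. norm (X n - L) \<le> e" by blast
  have "X \<longlonglongrightarrow> L"
  proof (rule LIMSEQ_I)
    fix e :: real assume "e > 0"
    then obtain M where "\<And>n. n \<ge> M \<Longrightarrow> norm (X n - L) \<le> e / 2" using L[of "e / 2"] by auto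
    then have "norm (X n - L) < e" if "n \<ge> M" for n
      using that \<open>e > 0\<close> by (smt (verit) field_sum_of_halves)
    then show "\<exists>M. \<forall>n\<ge>M. norm (X n - L) < e" by blast
  qed
  then show "convergent X" by (rule convergentI)
qed

lemma fock_cinner_summable:
  "(\<lambda>\<alpha>. cinner (coeff f \<alpha>) (coeff (g::('a, 'b::complex_hilbert_space) fock) \<alpha>)) summable_on A"
  by (intro summable_cinner summable_coeff)

instantiation fock :: (type, complex_hilbert_space) complex_hilbert_space
begin

lift_definition scaleC_fock :: "complex \<Rightarrow> ('a, 'b) fock \<Rightarrow> ('a, 'b) fock"
  is "\<lambda>c f \<alpha>. c *\<^sub>C f \<alpha>" by (rule sq_summable_scaleC)

definition cinner_fock :: "('a, 'b) fock \<Rightarrow> ('a, 'b) fock \<Rightarrow> complex"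
  where "cinner_fock f g = (\<Sum>\<^sub>\<infinity>\<alpha>. cinner (coeff f \<alpha>) (coeff g \<alpha>))"

instance
proof
  fix f g h :: "('a, 'b) fock" and c :: complex
  show "cinner f g = cnj (cinner g f)"
    unfolding cinner_fock_def infsum_cnj[symmetric] cinner_commute[symmetric] ..
  show "cinner (f + g) h = cinner f h + cinner g h"
    by (simp add: cinner_fock_def plus_fock.rep_eq cinner_add_left infsum_add fock_cinner_summable)
  show "cinner (c *\<^sub>C f) g = c * cinner f g"
    by (simp add: cinner_fock_def scaleC_fock.rep_eq cinner_scaleC_left infsum_cmult_right')
  show "norm f = sqrt (Re (cinner f f))"
    by (simp add: norm_fock_def cinner_fock_def infsum_Re[symmetric] fock_cinner_summable Re_cinner_self)
qed (auto intro!: fock_eqI simp: plus_fock.rep_eq scaleR_fock.rep_eq scaleC_fock.rep_eq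
    scaleC_add_right scaleC_add_left scaleC_scaleC scaleR_eq_scaleC)

end

lemma norm_fock_sq: "(norm f)\<^sup>2 = (\<Sum>\<^sub>\<infinity>\<alpha>. (norm (coeff f \<alpha>))\<^sup>2)"
  by (simp add: norm_fock_def infsum_nonneg)

text \<open>\<open>f \<otimes> x\<close> for \<open>f \<in> F\<^sup>2(H\<^sub>n)\<close> and \<open>x \<in> K\<close>, and the vectors \<open>e\<^sub>\<alpha>\<close>.\<close>

lift_definition tensor :: "('i, complex) fock \<Rightarrow> 'a::complex_hilbert_space \<Rightarrow> ('i, 'a) fock"
  is "\<lambda>f x \<alpha>. f \<alpha> *\<^sub>C x"
proof -
  fix f :: "'i list \<Rightarrow> complex" and x :: 'a
  assume "(\<lambda>\<alpha>. (norm (f \<alpha>))\<^sup>2) summable_on UNIV"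
  from summable_on_cmult_left[OF this, of "(norm x)\<^sup>2"]
  show "(\<lambda>\<alpha>. (norm (f \<alpha> *\<^sub>C x))\<^sup>2) summable_on UNIV"
    by (simp add: norm_scaleC power_mult_distrib)
qed

lift_definition basis_vec :: "'i list \<Rightarrow> ('i, complex) fock"
  is "\<lambda>\<alpha> \<beta>. if \<beta> = \<alpha> then 1 else 0"
proof -
  fix \<alpha> :: "'i list"
  have "finite {\<beta>. (cmod (if \<beta> = \<alpha> then 1 else 0))\<^sup>2 \<noteq> 0}"
    by (rule finite_subset[of _ "{\<alpha>}"]) auto
  then show "(\<lambda>\<beta>. (cmod (if \<beta> = \<alpha> then 1 else 0))\<^sup>2) summable_on UNIV"
    by (intro finite_nonzero_values_imp_summable_on) auto
qed

text \<open>\<open>S\<^sub>i \<otimes> I\<^sub>K\<close> and \<open>S\<^sub>\<alpha> \<otimes> I\<^sub>K\<close>; for \<open>K = \<complex>\<close> these are the left creation operators themselves.\<close>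

lift_definition creation :: "'i \<Rightarrow> ('i, 'a::complex_hilbert_space) fock \<Rightarrow> ('i, 'a) fock"
  is "\<lambda>i f \<alpha>. case \<alpha> of [] \<Rightarrow> 0 | j # \<beta> \<Rightarrow> if j = i then f \<beta> else 0"
proof -
  fix i and f :: "'i list \<Rightarrow> 'a"
  assume "(\<lambda>\<alpha>. (norm (f \<alpha>))\<^sup>2) summable_on UNIV"
  then have "(\<lambda>\<alpha>. (norm (case \<alpha> of [] \<Rightarrow> 0 | j # \<beta> \<Rightarrow> if j = i then f \<beta> else 0))\<^sup>2)
      summable_on range ((#) i)"
    by (subst summable_on_reindex) (auto simp: o_def)
  then show "(\<lambda>\<alpha>. (norm (case \<alpha> of [] \<Rightarrow> 0 | j # \<beta> \<Rightarrow> if j = i then f \<beta> else 0))\<^sup>2) summable_on UNIV"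
    by (rule summable_on_cong_neutral[THEN iffD1, rotated -1]) (auto split: list.splits)
qed

definition creation_word :: "'i list \<Rightarrow> ('i, 'a::complex_hilbert_space) fock \<Rightarrow> ('i, 'a) fock" where
  "creation_word \<alpha> = foldr creation \<alpha>"

text \<open>\<open>\<P>\<^sub>k \<otimes> K\<close>\<close>

definition poly_space :: "nat \<Rightarrow> ('i, 'a::complex_hilbert_space) fock set" where
  "poly_space k = {q. \<forall>\<alpha>. length \<alpha> > k \<longrightarrow> coeff q \<alpha> = 0}"

text \<open>
  \<open>M\<^sub>\<phi> (\<Sum>\<alpha>. e\<^sub>\<alpha> \<otimes> q\<^sub>\<alpha>) = \<Sum>\<alpha>. (S\<^sub>\<alpha> \<otimes> I) (\<phi> q\<^sub>\<alpha>)\<close>. The series converges for every polynomial \<open>q\<close> (see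
  \<open>mult_op_summable\<close>, which also covers infinitely many generators); elsewhere the value may be
  meaningless.
\<close>

definition mult_op ::
  "('k::complex_hilbert_space \<Rightarrow> ('i, 'a::complex_hilbert_space) fock) \<Rightarrow> ('i, 'k) fock \<Rightarrow> ('i, 'a) fock"
  where "mult_op \<phi> q = (\<Sum>\<^sub>\<infinity>\<alpha>. creation_word \<alpha> (\<phi> (coeff q \<alpha>)))"

definition poly_norm ::
  "nat \<Rightarrow> (('i, 'k::complex_hilbert_space) fock \<Rightarrow> ('i, 'a::complex_hilbert_space) fock) \<Rightarrow> ereal"
  where "poly_norm k M = (SUP q\<in>{q \<in> poly_space k. norm q \<le> 1}. ereal (norm (M q)))"

definition multi_analytic ::
  "(('i, 'e::complex_hilbert_space) fock \<Rightarrow> ('i, 'a::complex_hilbert_space) fock) \<Rightarrow> bool"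
  where "multi_analytic M \<longleftrightarrow> bounded_clinear M \<and> (\<forall>i f. M (creation i f) = creation i (M f))"

definition inner_multi_analytic ::
  "(('i, 'e::complex_hilbert_space) fock \<Rightarrow> ('i, 'a::complex_hilbert_space) fock) \<Rightarrow> bool"
  where "inner_multi_analytic M \<longleftrightarrow> multi_analytic M \<and> (\<forall>f. norm (M f) = norm f)"

definition symbol ::
  "(('i, 'e::complex_hilbert_space) fock \<Rightarrow> ('i, 'a::complex_hilbert_space) fock) \<Rightarrow> 'e \<Rightarrow> ('i, 'a) fock"
  where "symbol M h = M (tensor (basis_vec []) h)"


subsection \<open>The model of the tensor product\<close>

lemma cinner_tensor: "cinner (tensor f x) (tensor g y) = cinner f g * cinner x y"
proof -
  have "cinner (coeff (tensor f x) \<alpha>) (coeff (tensor g y) \<alpha>)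
      = cinner (coeff f \<alpha>) (coeff g \<alpha>) * cinner x y" for \<alpha>
    by (simp add: tensor.rep_eq cinner_scaleC_left cinner_scaleC_right cinner_complex_def)
  then show ?thesis
    unfolding cinner_fock_def by (simp only: infsum_cmult_left')
qed

lemma coeff_tensor_basis_vec: "coeff (tensor (basis_vec \<alpha>) x) \<beta> = (if \<beta> = \<alpha> then x else 0)"
  by (simp add: tensor.rep_eq basis_vec.rep_eq)

lemma cinner_basis_vec: "cinner (basis_vec \<alpha>) (basis_vec \<beta>) = (if \<alpha> = \<beta> then 1 else 0)"
proof -
  have "((\<lambda>\<gamma>. cinner (coeff (basis_vec \<alpha>) \<gamma>) (coeff (basis_vec \<beta>) \<gamma>))
      has_sum (if \<alpha> = \<beta> then 1 else 0)) UNIV"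
    by (rule has_sum_finite_neutralI[of "{\<alpha>}"]) (simp_all add: basis_vec.rep_eq cinner_complex_def)
  then show ?thesis unfolding cinner_fock_def by (rule infsumI)
qed

lemma creation_tensor: "creation i (tensor f x) = tensor (creation i f) x"
  by (rule fock_eqI) (simp add: creation.rep_eq tensor.rep_eq split: list.split)

lemma creation_basis_vec: "creation i (basis_vec \<alpha>) = basis_vec (i # \<alpha>)"
  by (rule fock_eqI) (simp add: creation.rep_eq basis_vec.rep_eq split: list.split)

lemma creation_word_basis_vec: "creation_word \<alpha> (basis_vec \<beta>) = basis_vec (\<alpha> @ \<beta>)"
  unfolding creation_word_def by (induction \<alpha>) (simp_all add: creation_basis_vec)

lemma creation_word_tensor: "creation_word \<alpha> (tensor f x) = tensor (creation_word \<alpha> f) x"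
  unfolding creation_word_def by (induction \<alpha>) (simp_all add: creation_tensor)

lemma norm_tensor_basis_vec: "norm (tensor (basis_vec \<alpha>) x) = norm x"
  unfolding norm_eq_sqrt_cinner[of "tensor (basis_vec \<alpha>) x"] norm_eq_sqrt_cinner[of x]
    cinner_tensor cinner_basis_vec by simp

lemma cinner_sum_right: "cinner x (sum f F) = (\<Sum>a\<in>F. cinner (x::'a::complex_hilbert_space) (f a))"
  by (induction F rule: infinite_finite_induct) (simp_all add: cinner_add_right)

lemma norm_sum_orthogonal_sq:
  fixes x :: "'b \<Rightarrow> 'a::complex_hilbert_space"
  assumes "finite F" "\<And>a b. a \<in> F \<Longrightarrow> b \<in> F \<Longrightarrow> a \<noteq> b \<Longrightarrow> cinner (x a) (x b) = 0"
  shows "(norm (sum x F))\<^sup>2 = (\<Sum>a\<in>F. (norm (x a))\<^sup>2)"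
  using assms
proof (induction F rule: finite_induct)
  case (insert a F)
  have "cinner (x a) (sum x F) = 0"
    unfolding cinner_sum_right by (rule sum.neutral) (use insert.prems insert.hyps in blast)
  moreover have "(norm (sum x F))\<^sup>2 = (\<Sum>a\<in>F. (norm (x a))\<^sup>2)"
    by (rule insert.IH) (use insert.prems in blast)
  ultimately show ?case using insert.hyps by (simp add: norm_add_sq)
qed simp

lemma orthogonal_summable:
  fixes x :: "'b \<Rightarrow> 'a::complex_hilbert_space"
  assumes orth: "\<And>a b. a \<in> A \<Longrightarrow> b \<in> A \<Longrightarrow> a \<noteq> b \<Longrightarrow> cinner (x a) (x b) = 0"
    and sq: "(\<lambda>a. (norm (x a))\<^sup>2) summable_on A"
  shows "x summable_on A"
proof -
  define s where "s = infsum (\<lambda>a. (norm (x a))\<^sup>2) A"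
  have lim: "(sum (\<lambda>a. (norm (x a))\<^sup>2) \<longlongrightarrow> s) (finite_subsets_at_top A)"
    unfolding s_def using sq by (rule infsum_tendsto)
  have "\<exists>P. eventually P (finite_subsets_at_top A) \<and>
      (\<forall>F F'. P F \<and> P F' \<longrightarrow> dist (sum x F) (sum x F') < e)" if "e > 0" for e
  proof -
    have "(e/2)\<^sup>2 > 0" using \<open>e > 0\<close> by simp
    then have "eventually (\<lambda>F. dist (sum (\<lambda>a. (norm (x a))\<^sup>2) F) s < (e/2)\<^sup>2) (finite_subsets_at_top A)"
      using lim unfolding tendsto_iff by blast
    then have "\<exists>F0. finite F0 \<and> F0 \<subseteq> A \<and> (\<forall>F. finite F \<and> F0 \<subseteq> F \<and> F \<subseteq> A \<longrightarrow>
        dist (sum (\<lambda>a. (norm (x a))\<^sup>2) F) s < (e/2)\<^sup>2)"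
      by (simp only: eventually_finite_subsets_at_top)
    then obtain F0 where F0: "finite F0" "F0 \<subseteq> A"
      and d: "\<And>F. finite F \<Longrightarrow> F0 \<subseteq> F \<Longrightarrow> F \<subseteq> A \<Longrightarrow> dist (sum (\<lambda>a. (norm (x a))\<^sup>2) F) s < (e/2)\<^sup>2"
      by (elim exE conjE) simp
    have le: "sum (\<lambda>a. (norm (x a))\<^sup>2) F \<le> s" if "finite F" "F \<subseteq> A" for F
      unfolding s_def using that by (intro finite_sum_le_infsum sq) simp_all
    have close: "dist (sum x F) (sum x F0) < e/2" if F: "finite F" "F0 \<subseteq> F" "F \<subseteq> A" for F
    proof -
      have "(norm (sum x (F - F0)))\<^sup>2 = sum (\<lambda>a. (norm (x a))\<^sup>2) (F - F0)"
        using F by (intro norm_sum_orthogonal_sq orth) auto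
      also have "\<dots> = sum (\<lambda>a. (norm (x a))\<^sup>2) F - sum (\<lambda>a. (norm (x a))\<^sup>2) F0"
        using F F0 by (intro sum_diff) auto
      also have "\<dots> < (e/2)\<^sup>2"
        using le[OF F(1,3)] d[OF F0(1) order_refl F0(2)] unfolding dist_real_def by linarith
      finally have "norm (sum x (F - F0)) < e/2"
        by (rule power_less_imp_less_base) (use \<open>e > 0\<close> in simp)
      then show ?thesis using F F0 by (simp only: dist_norm sum_diff)
    qed
    define P where "P F \<longleftrightarrow> finite F \<and> F0 \<subseteq> F \<and> F \<subseteq> A" for F
    have "eventually P (finite_subsets_at_top A)"
      unfolding eventually_finite_subsets_at_top P_def by (rule exI[of _ F0]) (simp add: F0)
    moreover have "dist (sum x F) (sum x F') < e" if "P F" "P F'" for F F'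
    proof -
      have "dist (sum x F) (sum x F0) < e/2" "dist (sum x F') (sum x F0) < e/2"
        using that unfolding P_def by (blast intro: close)+
      then show ?thesis
        using dist_triangle2[of "sum x F" "sum x F'" "sum x F0"] by linarith
    qed
    ultimately show ?thesis by blast
  qed
  then have "cauchy_filter (filtermap (sum x) (finite_subsets_at_top A))"
    by (simp add: cauchy_filter_metric_filtermap)
  moreover have "complete (UNIV::'a set)"
    by (meson Cauchy_convergent UNIV_I complete_def convergent_def)
  ultimately obtain L where "(sum x \<longlongrightarrow> L) (finite_subsets_at_top A)"
    using complete_uniform[where S=UNIV] by (force simp add: filterlim_def)
  then show ?thesis using summable_on_def has_sum_def by blast
qed

lemma bounded_linear_coeff: "bounded_linear (\<lambda>f. coeff f \<alpha>)"
  by (rule bounded_linear_intro[where K = 1])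
    (simp_all add: plus_fock.rep_eq scaleR_fock.rep_eq norm_coeff_le)

theorem has_sum_tensor_basis_vec:
  "((\<lambda>\<alpha>. tensor (basis_vec \<alpha>) (coeff f \<alpha>)) has_sum f) UNIV"
proof -
  have s: "(\<lambda>\<alpha>. tensor (basis_vec \<alpha>) (coeff f \<alpha>)) summable_on UNIV"
    by (rule orthogonal_summable)
      (auto simp: cinner_tensor cinner_basis_vec norm_tensor_basis_vec summable_coeff)
  have "(\<Sum>\<^sub>\<infinity>\<alpha>. tensor (basis_vec \<alpha>) (coeff f \<alpha>)) = f"
  proof (rule fock_eqI)
    fix \<beta>
    have "((\<lambda>\<alpha>. coeff (tensor (basis_vec \<alpha>) (coeff f \<alpha>)) \<beta>)
        has_sum coeff (\<Sum>\<^sub>\<infinity>\<alpha>. tensor (basis_vec \<alpha>) (coeff f \<alpha>)) \<beta>) UNIV"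
      using has_sum_bounded_linear[OF bounded_linear_coeff has_sum_infsum[OF s]] .
    moreover have "((\<lambda>\<alpha>. coeff (tensor (basis_vec \<alpha>) (coeff f \<alpha>)) \<beta>) has_sum coeff f \<beta>) UNIV"
      by (rule has_sum_finite_neutralI[of "{\<beta>}"]) (auto simp: coeff_tensor_basis_vec)
    ultimately show "coeff (\<Sum>\<^sub>\<infinity>\<alpha>. tensor (basis_vec \<alpha>) (coeff f \<alpha>)) \<beta> = coeff f \<beta>"
      by (rule has_sum_unique)
  qed
  then show ?thesis using has_sum_infsum[OF s] by simp
qed


subsection \<open>The operators \<open>M\<^sub>\<phi>\<close>\<close>

lemma norm_creation: "norm (creation i f) = norm f"
proof -
  have "(\<Sum>\<^sub>\<infinity>\<alpha>. (norm (coeff (creation i f) \<alpha>))\<^sup>2)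
      = (\<Sum>\<^sub>\<infinity>\<alpha>\<in>range ((#) i). (norm (coeff (creation i f) \<alpha>))\<^sup>2)"
    by (rule infsum_cong_neutral) (auto simp: creation.rep_eq split: list.splits)
  also have "\<dots> = (\<Sum>\<^sub>\<infinity>\<alpha>. (norm (coeff f \<alpha>))\<^sup>2)"
    by (subst infsum_reindex) (auto simp: o_def creation.rep_eq)
  finally show ?thesis by (simp add: norm_fock_def)
qed

lemma norm_creation_word: "norm (creation_word \<alpha> f) = norm f"
  unfolding creation_word_def by (induction \<alpha>) (simp_all add: norm_creation)

lemma creation_zero [simp]: "creation i 0 = 0"
  by (rule fock_eqI) (simp add: creation.rep_eq zero_fock.rep_eq split: list.split)

lemma creation_word_zero [simp]: "creation_word \<alpha> 0 = 0"
  unfolding creation_word_def by (induction \<alpha>) simp_all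

lemma coeff_creation_word:
  "coeff (creation_word \<alpha> f) \<beta>
    = (if take (length \<alpha>) \<beta> = \<alpha> then coeff f (drop (length \<alpha>) \<beta>) else 0)"
proof (induction \<alpha> arbitrary: \<beta>)
  case (Cons i \<alpha>)
  then show ?case
    by (cases \<beta>) (simp_all add: creation_word_def creation.rep_eq)
qed (simp add: creation_word_def)

lemma cinner_creation_word_orthogonal:
  assumes "length \<alpha> = length \<beta>" "\<alpha> \<noteq> \<beta>"
  shows "cinner (creation_word \<alpha> f) (creation_word \<beta> g) = 0"
proof -
  have "coeff (creation_word \<alpha> f) \<gamma> = 0 \<or> coeff (creation_word \<beta> g) \<gamma> = 0" for \<gamma>
    unfolding coeff_creation_word using assms by metis
  then have "cinner (coeff (creation_word \<alpha> f) \<gamma>) (coeff (creation_word \<beta> g) \<gamma>) = 0" for \<gamma>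
    by (metis cinner_zero_left cinner_zero_right)
  then show ?thesis unfolding cinner_fock_def by (intro infsum_0)
qed

theorem mult_op_summable:
  fixes \<phi> :: "'k::complex_hilbert_space \<Rightarrow> ('i, 'a::complex_hilbert_space) fock"
  assumes "bounded_clinear \<phi>" "q \<in> poly_space k"
  shows "(\<lambda>\<alpha>. creation_word \<alpha> (\<phi> (coeff q \<alpha>))) summable_on UNIV"
proof -
  interpret bounded_linear \<phi> using assms by (simp add: bounded_clinear_def)
  obtain K where K: "\<And>x. norm (\<phi> x) \<le> norm x * K" using bounded by blast
  have "(\<lambda>\<alpha>. creation_word \<alpha> (\<phi> (coeff q \<alpha>))) summable_on {\<alpha>. length \<alpha> = p}" for p
  proof (rule orthogonal_summable)
    show "(\<lambda>\<alpha>. (norm (creation_word \<alpha> (\<phi> (coeff q \<alpha>))))\<^sup>2) summable_on {\<alpha>. length \<alpha> = p}"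
    proof (rule summable_on_comparison_test)
      show "(\<lambda>\<alpha>. (norm (coeff q \<alpha>))\<^sup>2 * K\<^sup>2) summable_on {\<alpha>. length \<alpha> = p}"
        by (intro summable_on_cmult_left summable_coeff)
      show "(norm (creation_word \<alpha> (\<phi> (coeff q \<alpha>))))\<^sup>2 \<le> (norm (coeff q \<alpha>))\<^sup>2 * K\<^sup>2" for \<alpha>
        using power_mono[OF K norm_ge_zero, of "coeff q \<alpha>" 2]
        by (simp add: norm_creation_word power_mult_distrib)
    qed simp
  qed (auto intro: cinner_creation_word_orthogonal)
  then have "(\<lambda>\<alpha>. creation_word \<alpha> (\<phi> (coeff q \<alpha>))) summable_on (\<Union>p\<in>{..k}. {\<alpha>. length \<alpha> = p})"
    by (intro summable_on_finite_union_disjoint) auto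
  then show ?thesis
    by (rule summable_on_cong_neutral[THEN iffD1, rotated -1])
      (use assms(2) in \<open>auto simp: poly_space_def zero not_le\<close>)
qed

lemma mult_op_tensor_basis_vec:
  assumes "bounded_clinear \<phi>"
  shows "mult_op \<phi> (tensor (basis_vec \<alpha>) h) = creation_word \<alpha> (\<phi> h)"
proof -
  interpret bounded_linear \<phi> using assms by (simp add: bounded_clinear_def)
  have "mult_op \<phi> (tensor (basis_vec \<alpha>) h)
      = (\<Sum>\<^sub>\<infinity>\<beta>\<in>{\<alpha>}. creation_word \<beta> (\<phi> (coeff (tensor (basis_vec \<alpha>) h) \<beta>)))"
    unfolding mult_op_def by (rule infsum_cong_neutral) (auto simp: coeff_tensor_basis_vec zero)
  then show ?thesis by (simp add: coeff_tensor_basis_vec)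
qed

theorem multi_analytic_eq_mult_op:
  assumes "multi_analytic M"
  shows "M = mult_op (symbol M)"
proof
  fix f
  have M: "bounded_linear M" "\<And>i f. M (creation i f) = creation i (M f)"
    using assms by (auto simp: multi_analytic_def bounded_clinear_def)
  have "M (creation_word \<alpha> g) = creation_word \<alpha> (M g)" for \<alpha> g
    unfolding creation_word_def by (induction \<alpha>) (simp_all add: M)
  then have "M (tensor (basis_vec \<alpha>) h) = creation_word \<alpha> (symbol M h)" for \<alpha> h
    unfolding symbol_def using creation_word_tensor[of \<alpha> "basis_vec []" h]
    by (metis append_Nil2 creation_word_basis_vec)
  then show "M f = mult_op (symbol M) f"
    unfolding mult_op_def
    using infsumI[OF has_sum_bounded_linear[OF M(1) has_sum_tensor_basis_vec[of f]]] by simp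
qed

lemma bounded_linear_creation: "bounded_linear (creation i)"
proof (rule bounded_linear_intro[where K = 1])
  show "creation i (f + g) = creation i f + creation i g" for f g :: "('a, 'b) fock"
    by (rule fock_eqI) (simp add: creation.rep_eq plus_fock.rep_eq split: list.split)
  show "creation i (r *\<^sub>R f) = r *\<^sub>R creation i f" for r and f :: "('a, 'b) fock"
    by (rule fock_eqI) (simp add: creation.rep_eq scaleR_fock.rep_eq split: list.split)
qed (simp add: norm_creation)

lemma bounded_linear_creation_word: "bounded_linear (creation_word \<alpha>)"
  unfolding creation_word_def
  by (induction \<alpha>) (simp_all add: id_def o_def bounded_linear_ident
      bounded_linear_compose[OF bounded_linear_creation])

lemma mult_op_add:
  assumes "bounded_clinear \<phi>" "q \<in> poly_space k" "r \<in> poly_space k"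
  shows "mult_op \<phi> (q + r) = mult_op \<phi> q + mult_op \<phi> r"
proof -
  have "linear \<phi>" using assms by (simp add: bounded_clinear_def bounded_linear.linear)
  then have "creation_word \<alpha> (\<phi> (coeff (q + r) \<alpha>))
      = creation_word \<alpha> (\<phi> (coeff q \<alpha>)) + creation_word \<alpha> (\<phi> (coeff r \<alpha>))" for \<alpha>
    by (simp add: plus_fock.rep_eq linear_add
        linear_add[OF bounded_linear.linear[OF bounded_linear_creation_word]])
  then show ?thesis
    unfolding mult_op_def using assms by (simp add: infsum_add mult_op_summable)
qed

lemma mult_op_creation:
  assumes "bounded_clinear \<phi>" "q \<in> poly_space k"
  shows "mult_op \<phi> (creation i q) = creation i (mult_op \<phi> q)"
proof -
  have zero: "\<phi> 0 = 0" using assms by (simp add: bounded_clinear_def linear_0 bounded_linear.linear)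
  have "mult_op \<phi> (creation i q)
      = (\<Sum>\<^sub>\<infinity>\<alpha>\<in>range ((#) i). creation_word \<alpha> (\<phi> (coeff (creation i q) \<alpha>)))"
    unfolding mult_op_def
    by (rule infsum_cong_neutral) (auto simp: creation.rep_eq zero split: list.splits)
  also have "\<dots> = (\<Sum>\<^sub>\<infinity>\<alpha>. creation i (creation_word \<alpha> (\<phi> (coeff q \<alpha>))))"
    by (subst infsum_reindex) (auto simp: o_def creation.rep_eq creation_word_def)
  also have "\<dots> = creation i (mult_op \<phi> q)"
    unfolding mult_op_def
    by (rule infsumI[OF has_sum_bounded_linear[OF bounded_linear_creation has_sum_infsum]])
      (rule mult_op_summable[OF assms])
  finally show ?thesis .
qed

end

theory Submission
  imports Defs
begin

text \<open>
  Let \<open>N\<^sub>0\<close> be the range of \<open>M\<^sub>\<theta>\<close>, let \<open>N\<^sub>m\<^sub>+\<^sub>1\<close> be the closed span of the spaces \<open>S\<^sub>i N\<^sub>m\<close>, and let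
  \<open>H\<^sub>m\<close> be the complement of \<open>N\<^sub>m\<close>. Starting from \<open>B\<^sub>0 = A\<close>, the space \<open>H\<^sub>0\<close> is enlarged to
  \<open>H\<^sub>1 \<subseteq> H\<^sub>2 \<subseteq> \<dots>\<close>. Given a contraction \<open>B\<^sub>m\<close> into \<open>H\<^sub>m\<close>, the next contraction
  \<open>B\<^sub>m\<^sub>+\<^sub>1\<close> must compress to \<open>B\<^sub>m\<close> and must satisfy \<open>B\<^sub>m\<^sub>+\<^sub>1 S\<^sub>i q = S\<^sub>i B\<^sub>m q\<close> for \<open>S\<^sub>i q \<in> \<P>\<^sub>k\<close>; so a row
  and a column are prescribed, both contractive, and Parrott's lemma completes them.
  For each \<open>q\<close> the vectors \<open>B\<^sub>m q\<close> have orthogonal increments and bounded norms, hence converge. The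
  limit commutes with the \<open>S\<^sub>i\<close> inside \<open>\<P>\<^sub>k\<close>, so there it is \<open>M\<^sub>\<phi>'\<close> for some \<open>\<phi>'\<close>; as \<open>\<phi> - \<phi>'\<close> takes values
  in \<open>N\<^sub>0\<close>, it equals \<open>M\<^sub>\<theta> \<psi>\<close>.
\<close>

section \<open>Extending operators below a defect form\<close>

lemma bounded_clinearI:
  fixes T :: "'a::complex_hilbert_space \<Rightarrow> 'b::complex_hilbert_space"
  assumes "\<And>x y. T (x + y) = T x + T y" "\<And>c x. T (c *\<^sub>C x) = c *\<^sub>C T x"
    "\<And>x. norm (T x) \<le> norm x * K"
  shows "bounded_clinear T"
  unfolding bounded_clinear_def
  using assms by (auto intro!: bounded_linear_intro simp: scaleR_eq_scaleC)

lemma bounded_clinear_add: "bounded_clinear T \<Longrightarrow> T (x + y) = T x + T y"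
  by (simp add: bounded_clinear_def linear_add bounded_linear.linear)

lemma bounded_clinear_diff: "bounded_clinear T \<Longrightarrow> T (x - y) = T x - T y"
  by (simp add: bounded_clinear_def linear_diff bounded_linear.linear)

lemma bounded_clinear_zero: "bounded_clinear T \<Longrightarrow> T 0 = 0"
  by (simp add: bounded_clinear_def linear_0 bounded_linear.linear)

lemma bounded_clinear_scaleC: "bounded_clinear T \<Longrightarrow> T (c *\<^sub>C x) = c *\<^sub>C T x"
  by (simp add: bounded_clinear_def)

lemma bounded_clinear_sum: "bounded_clinear T \<Longrightarrow> T (sum f A) = (\<Sum>a\<in>A. T (f a))"
  by (simp add: bounded_clinear_def linear_sum bounded_linear.linear)

lemma bounded_linear_scaleC_right: "bounded_linear (\<lambda>x. c *\<^sub>C (x::'a::complex_hilbert_space))"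
  by (rule bounded_linear_intro[where K = "cmod c"])
    (simp_all add: scaleC_add_right norm_scaleC scaleR_eq_scaleC scaleC_scaleC mult.commute)

lemma scaleC_minus_one: "(- 1) *\<^sub>C x = - (x::'a::complex_hilbert_space)"
  using scaleC_add_left[of "-1" 1 x] by (simp add: eq_neg_iff_add_eq_0)

text \<open>A quadratic in t that is never negative has nonpositive discriminant. With
  \<open>a\<close> a squared seminorm this becomes a bound of Cauchy-Schwarz type with constant
  \<open>e\<close>.\<close>

lemma nonneg_quadratic_imp_le:
  fixes a b e :: real
  assumes "\<And>t. 0 \<le> t\<^sup>2 * a - 2 * t * b + e\<^sup>2" "a \<ge> 0" "e \<ge> 0"
  shows "b \<le> e * sqrt a"
proof (cases "a = 0")
  case True
  have "b \<le> 0"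
  proof (rule ccontr)
    assume "\<not> b \<le> 0"
    \<comment> \<open>Here the polynomial is affine in t, and at this t its value is -1.\<close>
    then show False using assms(1)[of "(e\<^sup>2 + 1) / (2 * b)"] True by simp
  qed
  then show ?thesis using True by simp
next
  case False
  with assms have a: "a > 0" by simp
  \<comment> \<open>The minimum of the quadratic is attained at \<open>b / a\<close>.\<close>
  have "0 \<le> (b / a)\<^sup>2 * a - 2 * (b / a) * b + e\<^sup>2" by (rule assms)
  also have "\<dots> = e\<^sup>2 - b\<^sup>2 / a" using a by (simp add: field_simps power2_eq_square)
  finally have "b\<^sup>2 \<le> e\<^sup>2 * a" using a by (simp add: field_simps)
  also have "\<dots> = (e * sqrt a)\<^sup>2" using a by (simp add: power_mult_distrib)
  finally show ?thesis by (rule power2_le_imp_le) (use assms(3) a in simp)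
qed

text \<open>The form of I - T*T, written without the adjoint. For a contraction it is positive
  semidefinite, possibly degenerate.\<close>

definition defect :: "('a::complex_hilbert_space \<Rightarrow> 'b::complex_hilbert_space) \<Rightarrow> 'a \<Rightarrow> 'a \<Rightarrow> complex"
  where "defect T x y = cinner x y - cinner (T x) (T y)"

lemma defect_add_left: "bounded_clinear T \<Longrightarrow> defect T (x + y) z = defect T x z + defect T y z"
  and defect_diff_left: "bounded_clinear T \<Longrightarrow> defect T (x - y) z = defect T x z - defect T y z"
  and defect_scaleC_left: "bounded_clinear T \<Longrightarrow> defect T (c *\<^sub>C x) z = c * defect T x z"
  and defect_scaleC_right: "bounded_clinear T \<Longrightarrow> defect T x (c *\<^sub>C z) = cnj c * defect T x z"
  by (simp_all add: defect_def bounded_clinear_add bounded_clinear_diff bounded_clinear_scaleC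
      cinner_add_left cinner_diff_left cinner_scaleC_left cinner_scaleC_right algebra_simps)

lemma Re_defect_self: "Re (defect T x x) = (norm x)\<^sup>2 - (norm (T x))\<^sup>2"
  by (simp add: defect_def Re_cinner_self)

lemma Re_defect_diff:
  assumes "bounded_clinear T"
  shows "Re (defect T (x - y) (x - y))
    = Re (defect T x x) + Re (defect T y y) - 2 * Re (defect T x y)"
  using norm_add_sq[of x "- y"] norm_add_sq[of "T x" "- T y"]
  by (simp add: Re_defect_self bounded_clinear_diff[OF assms] cinner_minus_right)
     (simp add: defect_def algebra_simps)

text \<open>
  This replaces Parrott's lemma. The extension is \<open>D\<close> applied to the projection onto \<open>W\<close> with
  respect to the semi-definite form \<open>defect T\<close>; \<open>near\<close> describes approximations to that projection,
  so that the completion of \<open>W\<close> need not be constructed.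
\<close>

theorem contraction_extension:
  fixes T :: "'a::complex_hilbert_space \<Rightarrow> 'b::complex_hilbert_space"
    and D :: "'a \<Rightarrow> 'c::complex_hilbert_space"
  assumes T: "bounded_clinear T" "\<And>x. norm (T x) \<le> norm x"
    and W: "0 \<in> W" "\<And>x y. x \<in> W \<Longrightarrow> y \<in> W \<Longrightarrow> x + y \<in> W" "\<And>c x. x \<in> W \<Longrightarrow> c *\<^sub>C x \<in> W"
    and Dadd: "\<And>x y. x \<in> W \<Longrightarrow> y \<in> W \<Longrightarrow> D (x + y) = D x + D y"
    and Dscale: "\<And>c x. x \<in> W \<Longrightarrow> D (c *\<^sub>C x) = c *\<^sub>C D x"
    and Dle: "\<And>x. x \<in> W \<Longrightarrow> (norm (D x))\<^sup>2 + (norm (T x))\<^sup>2 \<le> (norm x)\<^sup>2"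
  obtains E where "bounded_clinear E" "\<And>x. x \<in> W \<Longrightarrow> E x = D x"
    "\<And>x. (norm (E x))\<^sup>2 + (norm (T x))\<^sup>2 \<le> (norm x)\<^sup>2" "\<And>x. E x \<in> closure (D ` W)"
proof -
  define n where "n x = sqrt (Re (defect T x x))" for x
  have Q0: "Re (defect T x x) \<ge> 0" for x
    using power_mono[OF T(2) norm_ge_zero, of x 2] by (simp add: Re_defect_self)
  then have n2: "(n x)\<^sup>2 = Re (defect T x x)" and n0: "n x \<ge> 0" for x by (simp_all add: n_def)
  have n_le: "n x \<le> norm x" for x
    by (simp add: n_def Re_defect_self real_le_lsqrt)
  have n_scale: "n (c *\<^sub>C x) = cmod c * n x" for c x
    unfolding n_def Re_defect_self bounded_clinear_scaleC[OF T(1)] norm_scaleC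
    by (simp add: power_mult_distrib real_sqrt_mult flip: right_diff_distrib)
  have minus: "- x \<in> W" if "x \<in> W" for x
    using W(3)[OF that, of "-1"] by (simp add: scaleC_minus_one)
  have Wdiff: "x - y \<in> W" if "x \<in> W" "y \<in> W" for x y
    using W(2)[OF that(1) minus[OF that(2)]] by simp
  have Ddiff: "D (x - y) = D x - D y" if "x \<in> W" "y \<in> W" for x y
    using Dadd[OF Wdiff[OF that] that(2)] by simp
  have Dn: "norm (D x) \<le> n x" if "x \<in> W" for x
    by (rule power2_le_imp_le[OF _ n0]) (use Dle[OF that] in \<open>simp add: n2 Re_defect_self\<close>)
  \<comment> \<open>Orthogonality of \<open>h - x\<close> to \<open>W\<close> in the defect form, up
    to the error \<open>e\<close> relative to the seminorm \<open>n\<close>. These errors add when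
    pairs \<open>h\<close>, \<open>x\<close> are added, which will make the extension
    linear.\<close>
  define near where
    "near h x e \<longleftrightarrow> x \<in> W \<and> (\<forall>z\<in>W. cmod (defect T (h - x) z) \<le> e * n z)" for h x and e :: real
  have near_ex: "\<exists>x. near h x e" if "e > 0" for h e
  proof -
    \<comment> \<open>\<open>R\<close> holds the squared defect distances from \<open>h\<close> to
      points of \<open>W\<close>. A point within the square of \<open>e\<close> of the infimum is
      nearly orthogonal, since moving it inside \<open>W\<close> lowers the squared distance by less
      than that amount.\<close>
    define R where "R = (\<lambda>x. Re (defect T (h - x) (h - x))) ` W"
    have "R \<noteq> {}" "bdd_below R"
      using W(1) Q0 by (auto simp: R_def intro!: bdd_belowI[where m = 0])
    have "Inf R < Inf R + e\<^sup>2" using \<open>e > 0\<close> by simp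
    from cInf_lessD[OF \<open>R \<noteq> {}\<close> this]
    obtain x where x: "x \<in> W" "Re (defect T (h - x) (h - x)) < Inf R + e\<^sup>2"
      by (auto simp: R_def)
    have "cmod (defect T (h - x) z) \<le> e * n z" if "z \<in> W" for z
      unfolding n_def
    proof (rule nonneg_quadratic_imp_le)
      fix t :: real
      \<comment> \<open>The phase \<open>u\<close> turns the pairing with \<open>z\<close> into its
        modulus, leaving a real quadratic in \<open>t\<close>. If the pairing is 0 then
        \<open>sgn\<close> makes \<open>u\<close> zero, so only \<open>cmod u \<le> 1\<close> holds
        in general.\<close>
      define u where "u = sgn (defect T (h - x) z)"
      define w where "w = (complex_of_real t * u) *\<^sub>C z"
      have u: "cnj u * defect T (h - x) z = complex_of_real (cmod (defect T (h - x) z))"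
        by (cases "defect T (h - x) z = 0")
          (simp_all add: u_def sgn_eq complex_norm_square[symmetric] mult.commute power2_eq_square field_simps)
      have "w \<in> W" by (simp add: w_def W that)
      then have "x + w \<in> W" using W x by blast
      then have "Re (defect T (h - (x + w)) (h - (x + w))) \<in> R" unfolding R_def by blast
      then have "Inf R \<le> Re (defect T (h - x - w) (h - x - w))"
        using \<open>bdd_below R\<close> by (simp add: cInf_lower diff_diff_add)
      moreover have "Re (defect T (h - x) w) = t * cmod (defect T (h - x) z)"
        by (simp add: w_def defect_scaleC_right[OF T(1)] mult.assoc u)
      moreover have "Re (defect T w w) \<le> t\<^sup>2 * Re (defect T z z)"
      proof -
        have "Re (defect T w w) = (\<bar>t\<bar> * cmod u * n z)\<^sup>2"
          unfolding n2[symmetric] w_def by (simp add: n_scale norm_mult)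
        also have "\<dots> \<le> (\<bar>t\<bar> * 1 * n z)\<^sup>2"
          by (intro power_mono mult_right_mono mult_left_mono n0) (auto simp: u_def norm_sgn n0)
        finally show ?thesis by (simp add: power_mult_distrib n2)
      qed
      ultimately show "0 \<le> t\<^sup>2 * Re (defect T z z) - 2 * t * cmod (defect T (h - x) z) + e\<^sup>2"
        using x(2) Re_defect_diff[OF T(1), of "h - x" w] by simp
    qed (use Q0 \<open>e > 0\<close> in auto)
    then show ?thesis using x(1) unfolding near_def by blast
  qed
  have near_le: "n x \<le> n h + 2 * e" if "near h x e" "e \<ge> 0" for h x e
  proof -
    \<comment> \<open>Near orthogonality is tested against \<open>x\<close> itself; completing the
      square in \<open>n x\<close> then gives the bound.\<close>
    have "- cmod (defect T (h - x) x) \<le> Re (defect T (h - x) x)"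
      using complex_Re_le_cmod[of "- defect T (h - x) x"] by simp
    then have "Re (defect T (h - x) x) \<ge> - e * n x"
      using that by (force simp: near_def)
    moreover have "defect T h x = defect T (h - x) x + defect T x x"
      by (simp add: defect_diff_left[OF T(1)])
    ultimately have "(n h)\<^sup>2 \<ge> (n x)\<^sup>2 - 2 * e * n x"
      using Re_defect_diff[OF T(1), of h x] Q0[of "h - x"] by (simp add: n2)
    then have "(n x - e)\<^sup>2 \<le> (n h)\<^sup>2 + e\<^sup>2" by (simp add: power2_eq_square algebra_simps)
    also have "\<dots> \<le> (n h + e)\<^sup>2" using n0[of h] that by (simp add: power2_eq_square algebra_simps)
    finally have "n x - e \<le> n h + e" by (rule power2_le_imp_le) (use n0[of h] that in auto)
    then show ?thesis by simp
  qed
  have near_add: "near (h + h') (x + x') (e + e')" if "near h x e" "near h' x' e'" for h h' x x' e e'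
  proof -
    have "cmod (defect T (h + h' - (x + x')) z) \<le> (e + e') * n z" if "z \<in> W" for z
    proof -
      have "defect T (h + h' - (x + x')) z = defect T (h - x) z + defect T (h' - x') z"
        by (simp flip: defect_add_left[OF T(1)] add: algebra_simps)
      then have "cmod (defect T (h + h' - (x + x')) z)
          \<le> cmod (defect T (h - x) z) + cmod (defect T (h' - x') z)" by (simp add: norm_triangle_ineq)
      then show ?thesis
        using \<open>near h x e\<close> \<open>near h' x' e'\<close> that by (force simp: near_def algebra_simps)
    qed
    then show ?thesis using that W by (simp add: near_def)
  qed
  have near_scale: "near (c *\<^sub>C h) (c *\<^sub>C x) (cmod c * e)" if "near h x e" for c h x e
    using that W unfolding near_def
    by (auto simp: scaleC_diff_right[symmetric] defect_scaleC_left[OF T(1)] norm_mult mult.assoc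
        intro!: mult_left_mono)
  have near_minus: "near (- h) (- x) e" if "near h x e" for h x e
    using near_scale[OF that, of "-1"] by (simp add: scaleC_minus_one)
  \<comment> \<open>\<open>y\<close> is a limit of values \<open>D x\<close> along ever better
    approximate projections \<open>x\<close> of \<open>h\<close>. The vectors \<open>x\<close>
    themselves need not converge.\<close>
  define is_ext where
    "is_ext h y \<longleftrightarrow> (\<forall>e>0. \<exists>x. near h x e \<and> norm (D x - y) \<le> e)" for h y
  have ext_le: "norm y \<le> n h" if "is_ext h y" for h y
  proof (rule field_le_epsilon)
    fix e :: real assume "e > 0"
    then have "e / 3 > 0" by simp
    then obtain x where x: "near h x (e/3)" "norm (D x - y) \<le> e/3"
      using \<open>is_ext h y\<close> unfolding is_ext_def by blast
    have "norm y \<le> norm (D x) + norm (D x - y)"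
      by (metis add.commute norm_minus_commute norm_triangle_sub)
    then show "norm y \<le> n h + e"
      using x near_le[OF x(1)] Dn[of x] \<open>e > 0\<close> by (simp add: near_def)
  qed
  have ext_add: "is_ext (h + h') (y + y')" if "is_ext h y" "is_ext h' y'" for h h' y y'
    unfolding is_ext_def
  proof (intro allI impI)
    fix e :: real assume "e > 0"
    then have "e / 2 > 0" by simp
    then obtain x x' where x: "near h x (e/2)" "norm (D x - y) \<le> e/2"
      "near h' x' (e/2)" "norm (D x' - y') \<le> e/2"
      using \<open>is_ext h y\<close> \<open>is_ext h' y'\<close> unfolding is_ext_def by blast
    have eq: "D (x + x') - (y + y') = (D x - y) + (D x' - y')"
      using x by (simp add: near_def Dadd)
    then have "norm (D (x + x') - (y + y')) \<le> e"
      unfolding eq using x norm_triangle_ineq[of "D x - y" "D x' - y'"] by linarith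
    then show "\<exists>x. near (h + h') x e \<and> norm (D x - (y + y')) \<le> e"
      using near_add[OF x(1,3)] by auto
  qed
  have ext_scale: "is_ext (c *\<^sub>C h) (c *\<^sub>C y)" if "is_ext h y" for c h y
    unfolding is_ext_def
  proof (intro allI impI)
    fix e :: real assume "e > 0"
    \<comment> \<open>Adding 1 covers the case \<open>c = 0\<close> and still gives
      \<open>cmod c * d \<le> e\<close>.\<close>
    define d where "d = e / (cmod c + 1)"
    have pos: "cmod c + 1 > 0" using norm_ge_zero[of c] by linarith
    then have "d > 0" using \<open>e > 0\<close> by (simp add: d_def)
    then obtain x where x: "near h x d" "norm (D x - y) \<le> d"
      using \<open>is_ext h y\<close> unfolding is_ext_def by blast
    have "(cmod c + 1) * d = e" using pos by (simp add: d_def)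
    then have cd: "cmod c * d \<le> e" using \<open>d > 0\<close> by (simp add: algebra_simps)
    have "D (c *\<^sub>C x) - c *\<^sub>C y = c *\<^sub>C (D x - y)"
      using x by (simp add: near_def Dscale scaleC_diff_right)
    then have "norm (D (c *\<^sub>C x) - c *\<^sub>C y) \<le> e"
      using order_trans[OF mult_left_mono[OF x(2), of "cmod c"] cd] by (simp add: norm_scaleC)
    moreover have "near (c *\<^sub>C h) (c *\<^sub>C x) e"
      using near_scale[OF x(1), of c] mult_right_mono[OF cd n0]
      unfolding near_def by (blast intro: order_trans)
    ultimately show "\<exists>x. near (c *\<^sub>C h) x e \<and> norm (D x - c *\<^sub>C y) \<le> e" by blast
  qed
  have ext_W: "is_ext h (D h)" if "h \<in> W" for h
    using that n0 bounded_clinear_zero[OF T(1)]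
    by (auto simp: is_ext_def near_def defect_def intro!: exI[of _ h])
  have ext_ex: "\<exists>y. is_ext h y" for h
  proof -
    have "\<forall>m. \<exists>x. near h x (inverse (Suc m))" by (intro allI near_ex) simp
    then obtain x where x: "\<And>m. near h (x m) (inverse (Suc m))" by metis
    have xW: "x m \<in> W" for m using x by (simp add: near_def)
    \<comment> \<open>Two approximations for the same \<open>h\<close> differ by an approximation
      for 0. By \<open>near_le\<close> that difference is small in \<open>n\<close>, and
      \<open>n\<close> dominates \<open>D\<close> on \<open>W\<close>.\<close>
    have close: "norm (D (x m) - D (x l)) \<le> 2 * (inverse (Suc m) + inverse (Suc l))" for m l
    proof -
      have "near (h + - h) (x m + - x l) (inverse (Suc m) + inverse (Suc l))"
        by (intro near_add near_minus x)
      then have "near 0 (x m - x l) (inverse (Suc m) + inverse (Suc l))" by simp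
      from near_le[OF this] have "n (x m - x l) \<le> 2 * (inverse (Suc m) + inverse (Suc l))"
        by (simp add: n_def bounded_clinear_zero[OF T(1)] Re_defect_self)
      then show ?thesis using Dn[OF Wdiff[OF xW xW], of m l] by (simp add: Ddiff xW)
    qed
    have "Cauchy (\<lambda>m. D (x m))"
    proof (rule metric_CauchyI)
      fix e :: real assume "e > 0"
      then obtain N where N: "inverse (Suc N) < e / 4" using reals_Archimedean[of "e/4"] by auto
      have "dist (D (x m)) (D (x l)) < e" if "m \<ge> N" "l \<ge> N" for m l
      proof -
        have "norm (D (x m) - D (x l)) \<le> 2 * (inverse (Suc N) + inverse (Suc N))"
          using that by (intro order_trans[OF close] mult_left_mono add_mono le_imp_inverse_le) auto
        also have "\<dots> < e" using N by simp
        finally show ?thesis by (simp add: dist_norm)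
      qed
      then show "\<exists>M. \<forall>m\<ge>M. \<forall>n\<ge>M. dist (D (x m)) (D (x n)) < e" by blast
    qed
    then obtain y where y: "(\<lambda>m. D (x m)) \<longlonglongrightarrow> y" using Cauchy_convergent convergent_def by blast
    have "\<exists>x. near h x e \<and> norm (D x - y) \<le> e" if "e > 0" for e
    proof -
      have "eventually (\<lambda>m. norm (D (x m) - y) < e) sequentially"
        using y \<open>e > 0\<close> by (simp add: tendsto_iff dist_norm)
      moreover have "eventually (\<lambda>m. inverse (real (Suc m)) < e) sequentially"
        using order_tendstoD(2)[OF LIMSEQ_inverse_real_of_nat \<open>e > 0\<close>] .
      ultimately obtain m where m: "norm (D (x m) - y) < e" "inverse (real (Suc m)) < e"
        using eventually_conj[THEN eventually_happens'[OF sequentially_bot]] by blast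
      have "near h (x m) e"
        using x[of m] mult_right_mono[OF less_imp_le[OF m(2)] n0]
        unfolding near_def by (blast intro: order_trans)
      then show ?thesis using m(1) less_imp_le by blast
    qed
    then show ?thesis unfolding is_ext_def by blast
  qed
  have ext_unique: "y = y'" if "is_ext h y" "is_ext h y'" for h y y'
  proof -
    \<comment> \<open>The difference of two candidate values at \<open>h\<close> is a candidate at
      0, where \<open>ext_le\<close> bounds it by \<open>n 0 = 0\<close>.\<close>
    have "is_ext (h + (-1) *\<^sub>C h) (y + (-1) *\<^sub>C y')" by (intro ext_add ext_scale that)
    then have "is_ext 0 (y - y')" by (simp add: scaleC_minus_one)
    from ext_le[OF this] show ?thesis by (simp add: n_def bounded_clinear_zero[OF T(1)] Re_defect_self)
  qed
  define E where "E h = (SOME y. is_ext h y)" for h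
  have E: "is_ext h (E h)" for h unfolding E_def by (rule someI_ex[OF ext_ex])
  have E_eq: "E h = y" if "is_ext h y" for h y using ext_unique[OF E that] .
  show thesis
  proof
    show "bounded_clinear E"
    proof (rule bounded_clinearI[where K = 1])
      show "E (x + y) = E x + E y" for x y by (intro E_eq ext_add E)
      show "E (c *\<^sub>C x) = c *\<^sub>C E x" for c x by (intro E_eq ext_scale E)
      show "norm (E x) \<le> norm x * 1" for x using ext_le[OF E[of x]] n_le[of x] by simp
    qed
    show "E x = D x" if "x \<in> W" for x by (intro E_eq ext_W that)
    show "(norm (E x))\<^sup>2 + (norm (T x))\<^sup>2 \<le> (norm x)\<^sup>2" for x
      using power_mono[OF ext_le[OF E[of x]] norm_ge_zero, of 2] by (simp add: n2 Re_defect_self)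
    show "E x \<in> closure (D ` W)" for x
      unfolding closure_approachable
    proof (intro allI impI)
      fix e :: real assume "e > 0"
      then have "e / 2 > 0" by simp
      then obtain u where "near x u (e/2)" "norm (D u - E x) \<le> e/2"
        using E[of x] unfolding is_ext_def by blast
      then show "\<exists>y\<in>D ` W. dist y (E x) < e"
        using \<open>e > 0\<close> by (intro bexI[of _ "D u"]) (auto simp: near_def dist_norm)
    qed
  qed
qed

section \<open>Creation and annihilation operators\<close>

lemma creation_scaleC: "creation i (c *\<^sub>C f) = c *\<^sub>C creation i f"
  by (rule fock_eqI) (simp add: creation.rep_eq scaleC_fock.rep_eq split: list.split)

lemma bounded_clinear_creation: "bounded_clinear (creation i)"
  by (simp add: bounded_clinear_def bounded_linear_creation creation_scaleC)

lemma creation_word_Nil [simp]: "creation_word [] f = f"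
  and creation_word_Cons: "creation_word (i # \<alpha>) f = creation i (creation_word \<alpha> f)"
  by (simp_all add: creation_word_def)

lemma bounded_clinear_creation_word: "bounded_clinear (creation_word \<alpha>)"
proof -
  have "creation_word \<alpha> (c *\<^sub>C f) = c *\<^sub>C creation_word \<alpha> f" for c and f :: "('a, 'b) fock"
    by (induction \<alpha>) (simp_all add: creation_word_Cons creation_scaleC)
  then show ?thesis by (simp add: bounded_clinear_def bounded_linear_creation_word)
qed

lemma cinner_creation:
  "cinner (creation i f) (creation j g) = (if i = j then cinner f g else 0)"
proof (cases "i = j")
  case True
  have "(\<Sum>\<^sub>\<infinity>\<alpha>. cinner (coeff (creation i f) \<alpha>) (coeff (creation i g) \<alpha>))
      = (\<Sum>\<^sub>\<infinity>\<alpha>\<in>range ((#) i). cinner (coeff (creation i f) \<alpha>) (coeff (creation i g) \<alpha>))"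
    by (rule infsum_cong_neutral) (auto simp: creation.rep_eq split: list.splits)
  also have "\<dots> = (\<Sum>\<^sub>\<infinity>\<alpha>. cinner (coeff f \<alpha>) (coeff g \<alpha>))"
    by (subst infsum_reindex) (auto simp: o_def creation.rep_eq)
  finally show ?thesis using True by (simp add: cinner_fock_def)
next
  case False
  then show ?thesis
    using cinner_creation_word_orthogonal[of "[i]" "[j]" f g] by (simp add: creation_word_Cons)
qed

lemma norm_sum_creation_sq:
  "finite F \<Longrightarrow> (norm (\<Sum>i\<in>F. creation i (g i)))\<^sup>2 = (\<Sum>i\<in>F. (norm (g i))\<^sup>2)"
  by (subst norm_sum_orthogonal_sq) (auto simp: cinner_creation norm_creation)

text \<open>On coefficients this is the adjoint of \<open>creation i\<close>.\<close>

lift_definition annihilation :: "'i \<Rightarrow> ('i, 'a::complex_hilbert_space) fock \<Rightarrow> ('i, 'a) fock"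
  is "\<lambda>i f \<alpha>. f (i # \<alpha>)"
proof -
  fix i and f :: "'i list \<Rightarrow> 'a"
  assume "(\<lambda>\<alpha>. (norm (f \<alpha>))\<^sup>2) summable_on UNIV"
  then have "(\<lambda>\<alpha>. (norm (f \<alpha>))\<^sup>2) summable_on range ((#) i)"
    by (rule summable_on_subset_banach) simp
  then show "(\<lambda>\<alpha>. (norm (f (i # \<alpha>)))\<^sup>2) summable_on UNIV"
    by (subst (asm) summable_on_reindex) (auto simp: o_def)
qed

lemma annihilation_add: "annihilation i (f + g) = annihilation i f + annihilation i g"
  and annihilation_scaleC: "annihilation i (c *\<^sub>C f) = c *\<^sub>C annihilation i f"
  and annihilation_zero [simp]: "annihilation i 0 = 0"
  by (rule fock_eqI; simp add: annihilation.rep_eq plus_fock.rep_eq scaleC_fock.rep_eq zero_fock.rep_eq)+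

lemma annihilation_creation: "annihilation i (creation j f) = (if i = j then f else 0)"
  by (rule fock_eqI) (simp add: annihilation.rep_eq creation.rep_eq zero_fock.rep_eq)

lemma coeff_sum: "coeff (sum f A) \<alpha> = (\<Sum>a\<in>A. coeff (f a) \<alpha>)"
  using linear_sum[OF bounded_linear.linear[OF bounded_linear_coeff]] .

text \<open>The ranges of the creation operators together fill the complement of the constants, so
  summing the projections onto these ranges recovers a vector without constant term. The finite set
  \<open>F\<close> avoids a convergence question when there are infinitely many generators.\<close>

lemma sum_creation_annihilation:
  assumes "coeff f [] = 0" "finite F" "{i. annihilation i f \<noteq> 0} \<subseteq> F"
  shows "(\<Sum>i\<in>F. creation i (annihilation i f)) = f"
proof (rule fock_eqI)
  fix \<alpha>
  show "coeff (\<Sum>i\<in>F. creation i (annihilation i f)) \<alpha> = coeff f \<alpha>"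
  proof (cases \<alpha>)
    case Nil
    then show ?thesis using assms by (simp add: coeff_sum creation.rep_eq)
  next
    case (Cons j \<beta>)
    have "coeff f (j # \<beta>) = 0" if "j \<notin> F"
    proof -
      have "annihilation j f = 0" using assms that by blast
      then show ?thesis by (metis annihilation.rep_eq zero_fock.rep_eq)
    qed
    then show ?thesis
      using assms(2) by (auto simp: Cons coeff_sum creation.rep_eq annihilation.rep_eq sum.delta')
  qed
qed

section \<open>Stability properties of the polynomial spaces\<close>

lemma poly_space_add: "f \<in> poly_space k \<Longrightarrow> g \<in> poly_space k \<Longrightarrow> f + g \<in> poly_space k"
  and poly_space_scaleC: "f \<in> poly_space k \<Longrightarrow> c *\<^sub>C f \<in> poly_space k"
  and poly_space_zero: "0 \<in> poly_space k"
  by (simp_all add: poly_space_def plus_fock.rep_eq scaleC_fock.rep_eq zero_fock.rep_eq)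

lemma creation_annihilation_poly_space:
  "f \<in> poly_space k \<Longrightarrow> creation i (annihilation i f) \<in> poly_space k"
  by (auto simp: poly_space_def creation.rep_eq annihilation.rep_eq split: list.split)

lemma creation_poly_spaceD:
  fixes q :: "('i, 'a::complex_hilbert_space) fock"
  shows "creation i q \<in> poly_space k \<Longrightarrow> q \<in> poly_space k"
  unfolding poly_space_def
proof safe
  fix \<alpha> :: "'i list" assume "\<forall>\<alpha>. length \<alpha> > k \<longrightarrow> coeff (creation i q) \<alpha> = 0" and "length \<alpha> > k"
  then have "coeff (creation i q) (i # \<alpha>) = 0" by simp
  then show "coeff q \<alpha> = 0" by (simp add: creation.rep_eq)
qed

section \<open>Lifting one step\<close>

lemma ortho_compl_antimono: "S \<subseteq> S' \<Longrightarrow> ortho_compl S' \<subseteq> ortho_compl S"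
  by (auto simp: ortho_compl_def)

lemma ortho_compl_sym: "x \<in> ortho_compl S \<Longrightarrow> y \<in> S \<Longrightarrow> cinner y x = 0"
  unfolding ortho_compl_def by (subst cinner_commute) simp

lemma subset_ortho_compl2: "S \<subseteq> ortho_compl (ortho_compl S)"
  unfolding ortho_compl_def by (auto simp: ortho_compl_def intro: ortho_compl_sym)

lemma ortho_compl_sum: "(\<And>a. a \<in> A \<Longrightarrow> f a \<in> ortho_compl S) \<Longrightarrow> sum f A \<in> ortho_compl S"
  by (induction A rule: infinite_finite_induct) (simp_all add: ortho_compl_add zero_in_ortho_compl)

text \<open>
  Modulo \<open>N\<close>, the double complement of \<open>G\<close>, \<open>B\<close> is the compression of some \<open>M\<^sub>\<phi>\<close> on \<open>\<P>\<^sub>k\<close>.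
\<close>

definition partial_lifting where
  "partial_lifting k G B \<longleftrightarrow> bounded_clinear B \<and> (\<forall>q. norm (B q) \<le> norm q) \<and>
    (\<forall>q. B q \<in> ortho_compl G) \<and>
    (\<forall>i q. creation i q \<in> poly_space k \<longrightarrow>
      creation i (B q) - B (creation i q) \<in> ortho_compl (ortho_compl G))"

text \<open>\<open>G\<close> represents the closed subspace that is its double complement. A plain
  union suffices here, because the double complement of the union is the closed span of the shifted
  spaces.\<close>

definition next_space :: "('i, 'a::complex_hilbert_space) fock set \<Rightarrow> ('i, 'a) fock set" where
  "next_space G = (\<Union>i. creation i ` ortho_compl (ortho_compl G))"

lemma next_space_subset:
  assumes "\<And>i y. y \<in> ortho_compl (ortho_compl G) \<Longrightarrow> creation i y \<in> ortho_compl (ortho_compl G)"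
  shows "ortho_compl (ortho_compl (next_space G)) \<subseteq> ortho_compl (ortho_compl G)"
proof -
  have "next_space G \<subseteq> ortho_compl (ortho_compl G)" using assms by (auto simp: next_space_def)
  then show ?thesis
    using subset_ortho_compl2[of "ortho_compl G"]
    by (meson ortho_compl_antimono subset_trans)
qed

text \<open>The new space lies inside the old one, so a shift of any of its elements is already a
  generator of the new space.\<close>

lemma next_space_invariant:
  assumes "\<And>i y. y \<in> ortho_compl (ortho_compl G) \<Longrightarrow> creation i y \<in> ortho_compl (ortho_compl G)"
    and "y \<in> ortho_compl (ortho_compl (next_space G))"
  shows "creation i y \<in> ortho_compl (ortho_compl (next_space G))"
proof -
  have "creation i y \<in> next_space G"
    using next_space_subset[of G] assms by (auto simp: next_space_def)
  then show ?thesis using subset_ortho_compl2 by blast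
qed

text \<open>The new operator is sought as \<open>B + E\<close> with \<open>E\<close> valued in the
  double complement of \<open>G\<close>, hence orthogonal to the values of \<open>B\<close>.
  Contractivity then says exactly that \<open>E\<close> is dominated by the defect of
  \<open>B\<close>. The shift rule prescribes \<open>E\<close> on a subspace, where domination holds
  because the creation operators are isometries with orthogonal ranges, and
  \<open>contraction_extension\<close> supplies the rest.\<close>

theorem partial_lifting_step:
  fixes G :: "('i, 'a::complex_hilbert_space) fock set"
    and B :: "('i, 'k::complex_hilbert_space) fock \<Rightarrow> ('i, 'a) fock"
  assumes inv: "\<And>i y. y \<in> ortho_compl (ortho_compl G) \<Longrightarrow> creation i y \<in> ortho_compl (ortho_compl G)"
    and B: "partial_lifting k G B"
  obtains B' where "partial_lifting k (next_space G) B'"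
    "\<And>q. B' q - B q \<in> ortho_compl (ortho_compl G)"
    "\<And>i q. creation i q \<in> poly_space k \<Longrightarrow> B' (creation i q) = creation i (B q)"
proof -
  let ?H = "ortho_compl G" and ?N = "ortho_compl (ortho_compl G)"
  let ?H' = "ortho_compl (next_space G)"
  have lin: "bounded_clinear B" and le: "norm (B q) \<le> norm q" and BH: "B q \<in> ?H"
    and BN: "creation i q \<in> poly_space k \<Longrightarrow> creation i (B q) - B (creation i q) \<in> ?N" for i q
    using B by (auto simp: partial_lifting_def)
  have HH': "?H \<subseteq> ?H'"
  proof -
    have "next_space G \<subseteq> ?N" using inv by (auto simp: next_space_def)
    then show ?thesis using subset_ortho_compl2[of ?H] ortho_compl_antimono by blast
  qed
  \<comment> \<open>The shifted vector is orthogonal to the ranges of the other creation operators.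
    Within the range of \<open>creation i\<close> the orthogonality of \<open>y\<close> to
    \<open>?N\<close> is preserved.\<close>
  have SH: "creation i y \<in> ?H'" if "y \<in> ?H" for i y
    unfolding ortho_compl_def[of "next_space G"]
    by (auto simp: next_space_def cinner_creation ortho_compl_sym[OF _ that])
  \<comment> \<open>Finitely many initial letters keep \<open>V\<close>, the column prescribed by
    the shift rule, a finite sum even with infinitely many generators. The extension theorem covers
    the remaining vectors.\<close>
  define supp where "supp f = {i. annihilation i f \<noteq> 0}" for f :: "('i, 'k) fock"
  define W where "W = {f \<in> poly_space k. coeff f [] = 0 \<and> finite (supp f)}"
  define V where "V f = (\<Sum>i\<in>supp f. creation i (B (annihilation i f)))" for f
  \<comment> \<open>Enlarging the index set lets \<open>f\<close>, \<open>g\<close> and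
    \<open>f + g\<close> share one sum.\<close>
  have V_eq: "V f = (\<Sum>i\<in>F. creation i (B (annihilation i f)))"
    if "finite F" "supp f \<subseteq> F" for f F
    unfolding V_def using that
    by (intro sum.mono_neutral_left) (auto simp: supp_def bounded_clinear_zero[OF lin])
  have supp_add: "supp (f + g) \<subseteq> supp f \<union> supp g" and supp_scale: "supp (c *\<^sub>C f) \<subseteq> supp f" for f g c
    by (auto simp: supp_def annihilation_add annihilation_scaleC)
  have f_eq: "(\<Sum>i\<in>supp f. creation i (annihilation i f)) = f" if "f \<in> W" for f
    using that by (intro sum_creation_annihilation) (auto simp: W_def supp_def)
  have W: "0 \<in> W" "\<And>f g. f \<in> W \<Longrightarrow> g \<in> W \<Longrightarrow> f + g \<in> W" "\<And>c f. f \<in> W \<Longrightarrow> c *\<^sub>C f \<in> W"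
    by (auto simp: W_def poly_space_add poly_space_scaleC poly_space_zero plus_fock.rep_eq
        zero_fock.rep_eq scaleC_fock.rep_eq supp_def[of 0]
        intro: finite_subset[OF supp_add] finite_subset[OF supp_scale])
  have V_add: "V (f + g) = V f + V g" if "f \<in> W" "g \<in> W" for f g
  proof -
    have fin: "finite (supp f \<union> supp g)" using that by (simp add: W_def)
    show ?thesis
      by (simp add: V_eq[OF fin] supp_add annihilation_add bounded_clinear_add[OF lin]
          bounded_clinear_add[OF bounded_clinear_creation] sum.distrib)
  qed
  have V_scale: "V (c *\<^sub>C f) = c *\<^sub>C V f" if "f \<in> W" for c f
  proof -
    have fin: "finite (supp f)" using that by (simp add: W_def)
    have "c *\<^sub>C (\<Sum>i\<in>F. g i) = (\<Sum>i\<in>F. c *\<^sub>C g i)" for F and g :: "'i \<Rightarrow> ('i, 'a) fock"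
      by (induction F rule: infinite_finite_induct) (simp_all add: scaleC_add_right)
    then show ?thesis
      by (simp add: V_eq[OF fin] supp_scale annihilation_scaleC bounded_clinear_scaleC[OF lin]
          creation_scaleC)
  qed
  have VH': "V f \<in> ?H'" for f
    unfolding V_def by (intro ortho_compl_sum SH BH)
  \<comment> \<open>After splitting \<open>f\<close> by initial letters, the last clause of
    \<open>partial_lifting\<close> exchanges \<open>B\<close> with each \<open>creation i\<close>
    modulo \<open>?N\<close>.\<close>
  have VN: "V f - B f \<in> ?N" if "f \<in> W" for f
  proof -
    have "B f = (\<Sum>i\<in>supp f. B (creation i (annihilation i f)))"
      by (subst f_eq[OF that, symmetric]) (simp add: bounded_clinear_sum[OF lin])
    then have "V f - B f
        = (\<Sum>i\<in>supp f. creation i (B (annihilation i f)) - B (creation i (annihilation i f)))"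
      by (simp add: V_def sum_subtractf)
    also have "\<dots> \<in> ?N"
      using that by (intro ortho_compl_sum BN creation_annihilation_poly_space) (simp add: W_def)
    finally show ?thesis .
  qed
  have V_le: "(norm (V f))\<^sup>2 \<le> (norm f)\<^sup>2" if "f \<in> W" for f
  proof -
    have fin: "finite (supp f)" using that by (simp add: W_def)
    have "(norm (V f))\<^sup>2 = (\<Sum>i\<in>supp f. (norm (B (annihilation i f)))\<^sup>2)"
      unfolding V_def by (rule norm_sum_creation_sq[OF fin])
    also have "\<dots> \<le> (\<Sum>i\<in>supp f. (norm (annihilation i f))\<^sup>2)"
      by (intro sum_mono power_mono le norm_ge_zero)
    also have "\<dots> = (norm (\<Sum>i\<in>supp f. creation i (annihilation i f)))\<^sup>2"
      by (rule norm_sum_creation_sq[OF fin, symmetric])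
    finally show ?thesis by (simp add: f_eq[OF that])
  qed
  have pyth: "(norm (B q + y))\<^sup>2 = (norm y)\<^sup>2 + (norm (B q))\<^sup>2" if "y \<in> ?N" for q y
    using ortho_compl_sym[OF that BH, of q] by (simp add: norm_add_sq)
  obtain E where E: "bounded_clinear E" "\<And>x. x \<in> W \<Longrightarrow> E x = V x - B x"
    "\<And>x. (norm (E x))\<^sup>2 + (norm (B x))\<^sup>2 \<le> (norm x)\<^sup>2" "\<And>x. E x \<in> closure ((\<lambda>f. V f - B f) ` W)"
  proof (rule contraction_extension[of B W "\<lambda>f. V f - B f"])
    show "(norm (V f - B f))\<^sup>2 + (norm (B f))\<^sup>2 \<le> (norm f)\<^sup>2" if "f \<in> W" for f
      using pyth[OF VN[OF that], of f] V_le[OF that] by simp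
  qed (auto simp: lin le W V_add V_scale bounded_clinear_add[OF lin] bounded_clinear_scaleC[OF lin]
      scaleC_diff_right)
  \<comment> \<open>The prescribed values lie in a closed subspace. Since \<open>E\<close> takes its
    values in their closure, it stays there on the whole space.\<close>
  have "(\<lambda>f. V f - B f) ` W \<subseteq> ?H' \<inter> ?N"
    using VN ortho_compl_diff[OF VH' subsetD[OF HH' BH]] by auto
  then have "closure ((\<lambda>f. V f - B f) ` W) \<subseteq> ?H' \<inter> ?N"
    by (intro closure_minimal closed_Int closed_ortho_compl)
  then have EH: "E x \<in> ?H'" and EN: "E x \<in> ?N" for x
    using E(4) by blast+
  define B' where "B' q = B q + E q" for q
  have B'S: "B' (creation i q) = creation i (B q)" if "creation i q \<in> poly_space k" for i q
  proof -
    have s: "supp (creation i q) \<subseteq> {i}" by (auto simp: supp_def annihilation_creation)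
    then have "creation i q \<in> W"
      using that by (auto simp: W_def creation.rep_eq intro: finite_subset)
    then have "B' (creation i q) = V (creation i q)" by (simp add: B'_def E)
    then show ?thesis using V_eq[OF _ s] by (simp add: annihilation_creation)
  qed
  have B'B: "B' q - B q \<in> ?N" for q by (simp add: B'_def EN)
  have B'_le: "norm (B' q) \<le> norm q" for q
    by (rule power2_le_imp_le) (use pyth[OF EN] E(3) in \<open>simp_all add: B'_def\<close>)
  have "bounded_clinear B'"
    by (rule bounded_clinearI[where K = 1])
      (use B'_le in \<open>simp_all add: B'_def bounded_clinear_add[OF lin] bounded_clinear_add[OF E(1)]
        bounded_clinear_scaleC[OF lin] bounded_clinear_scaleC[OF E(1)] scaleC_add_right algebra_simps\<close>)
  moreover have "B' q \<in> ?H'" for q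
    using HH' BH EH by (auto simp: B'_def intro!: ortho_compl_add)
  moreover have "creation i (B' q) - B' (creation i q) \<in> ortho_compl ?H'"
    if "creation i q \<in> poly_space k" for i q
  proof -
    \<comment> \<open>As \<open>B'\<close> on a shifted vector is computed from the old
      \<open>B\<close>, the error is the shift of an increment in \<open>?N\<close>. This dictates
      the choice of \<open>next_space\<close>.\<close>
    have "creation i (B' q) - B' (creation i q) = creation i (B' q - B q)"
      by (simp add: B'S[OF that] bounded_clinear_diff[OF bounded_clinear_creation])
    also have "\<dots> \<in> next_space G" using B'B by (auto simp: next_space_def)
    finally show ?thesis using subset_ortho_compl2 by blast
  qed
  ultimately have "partial_lifting k (next_space G) B'" by (simp add: partial_lifting_def B'_le)
  then show thesis using that B'B B'S by blast
qed

section \<open>Iteration of the one-step lifting and its limit\<close>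

theorem lifting:
  fixes G :: "('i, 'a::complex_hilbert_space) fock set"
    and B\<^sub>0 :: "('i, 'k::complex_hilbert_space) fock \<Rightarrow> ('i, 'a) fock"
  assumes inv: "\<And>i y. y \<in> ortho_compl (ortho_compl G) \<Longrightarrow> creation i y \<in> ortho_compl (ortho_compl G)"
    and B\<^sub>0: "partial_lifting k G B\<^sub>0"
  obtains L where "bounded_clinear L" "\<And>q. norm (L q) \<le> norm q"
    "\<And>i q. creation i q \<in> poly_space k \<Longrightarrow> L (creation i q) = creation i (L q)"
    "\<And>q. L q - B\<^sub>0 q \<in> ortho_compl (ortho_compl G)"
proof -
  define Gs where "Gs m = (next_space ^^ m) G" for m
  have Gs: "Gs 0 = G" "Gs (Suc m) = next_space (Gs m)" for m by (simp_all add: Gs_def)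
  define N where "N m = ortho_compl (ortho_compl (Gs m))" for m
  have invN: "\<forall>i. \<forall>y\<in>N m. creation i y \<in> N m" for m
    by (induction m) (auto simp: N_def Gs inv intro: next_space_invariant)
  \<comment> \<open>The clause for \<open>m = 0\<close> is part of the invariant so that the chosen
    sequence starts at the given operator.\<close>
  have "\<exists>B. \<forall>m. (partial_lifting k (Gs m) (B m) \<and> (m = 0 \<longrightarrow> B m = B\<^sub>0)) \<and>
      ((\<forall>q. B (Suc m) q - B m q \<in> N m) \<and>
       (\<forall>i q. creation i q \<in> poly_space k \<longrightarrow> B (Suc m) (creation i q) = creation i (B m q)))"
  proof (rule dependent_nat_choice)
    show "\<exists>B. partial_lifting k (Gs 0) B \<and> (0 = (0::nat) \<longrightarrow> B = B\<^sub>0)" using B\<^sub>0 by (auto simp: Gs)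
  next
    fix B m assume "partial_lifting k (Gs m) B \<and> (m = 0 \<longrightarrow> B = B\<^sub>0)"
    with invN[of m] partial_lifting_step[of "Gs m" k B]
    show "\<exists>B'. (partial_lifting k (Gs (Suc m)) B' \<and> (Suc m = 0 \<longrightarrow> B' = B\<^sub>0)) \<and>
      ((\<forall>q. B' q - B q \<in> N m) \<and>
       (\<forall>i q. creation i q \<in> poly_space k \<longrightarrow> B' (creation i q) = creation i (B q)))"
      unfolding Gs N_def by (metis nat.distinct(1))
  qed
  then obtain B where B: "\<And>m. partial_lifting k (Gs m) (B m)" "B 0 = B\<^sub>0"
    and BN: "\<And>m q. B (Suc m) q - B m q \<in> N m"
    and BS: "\<And>m i q. creation i q \<in> poly_space k \<Longrightarrow> B (Suc m) (creation i q) = creation i (B m q)"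
    by metis
  have lin: "bounded_clinear (B m)" and le: "norm (B m q) \<le> norm q"
    and BH: "B m q \<in> ortho_compl (Gs m)" for m q
    using B by (auto simp: partial_lifting_def)
  have N_Suc: "N (Suc m) \<subseteq> N m" for m
    unfolding N_def Gs by (rule next_space_subset) (use invN[of m] in \<open>simp add: N_def\<close>)
  have N_mono: "N n \<subseteq> N m" if "m \<le> n" for m n
    using lift_Suc_antimono_le[of N, OF N_Suc that] .
  have BmN: "B n q - B m q \<in> N m" if "m \<le> n" for m n q
    using that
  proof (induction n rule: dec_induct)
    case base
    then show ?case by (simp add: N_def zero_in_ortho_compl)
  next
    case (step n)
    have "B (Suc n) q - B m q = (B (Suc n) q - B n q) + (B n q - B m q)" by simp
    also have "\<dots> \<in> N m"
      using step BN N_mono[OF step(1)] unfolding N_def by (blast intro: ortho_compl_add)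
    finally show ?case .
  qed
  \<comment> \<open>The increment lies in \<open>N m\<close>, which is orthogonal to the value
    \<open>B m q\<close>.\<close>
  have pyth: "(norm (B n q - B m q))\<^sup>2 = (norm (B n q))\<^sup>2 - (norm (B m q))\<^sup>2" if "m \<le> n" for m n q
    using norm_add_sq[of "B m q" "B n q - B m q"] ortho_compl_sym[OF BmN[OF that, of q, unfolded N_def] BH]
    by simp
  have "Cauchy (\<lambda>m. B m q)" for q
  proof (rule CauchyI')
    fix e :: real assume "e > 0"
    \<comment> \<open>The squared norms increase and are bounded, hence form a Cauchy sequence; by
      \<open>pyth\<close> their differences are the squared distances of the vectors.\<close>
    have "incseq (\<lambda>m. (norm (B m q))\<^sup>2)"
      by (rule monoI) (use pyth in \<open>metis diff_ge_0_iff_ge zero_le_power2\<close>)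
    moreover have "(norm (B m q))\<^sup>2 \<le> (norm q)\<^sup>2" for m by (intro power_mono le norm_ge_zero)
    ultimately have "convergent (\<lambda>m. (norm (B m q))\<^sup>2)"
      by (metis convergentI incseq_convergent)
    then have "Cauchy (\<lambda>m. (norm (B m q))\<^sup>2)" by (rule convergent_Cauchy)
    moreover have "e\<^sup>2 > 0" using \<open>e > 0\<close> by simp
    ultimately obtain M where M: "\<And>m n. m \<ge> M \<Longrightarrow> n \<ge> M \<Longrightarrow>
        dist ((norm (B m q))\<^sup>2) ((norm (B n q))\<^sup>2) < e\<^sup>2"
      unfolding Cauchy_def by blast
    have "dist (B m q) (B n q) < e" if "m \<ge> M" "n > m" for m n
    proof -
      have "(norm (B n q - B m q))\<^sup>2 < e\<^sup>2"
        using M[of n m] that pyth[of m n q] by (simp add: dist_real_def)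
      then show ?thesis
        using \<open>e > 0\<close> by (simp add: dist_norm norm_minus_commute power_less_imp_less_base)
    qed
    then show "\<exists>M. \<forall>m\<ge>M. \<forall>n>m. dist (B m q) (B n q) < e" by blast
  qed
  then have "\<forall>q. \<exists>l. (\<lambda>m. B m q) \<longlonglongrightarrow> l" using Cauchy_convergent convergent_def by blast
  then obtain L where L: "\<And>q. (\<lambda>m. B m q) \<longlonglongrightarrow> L q" by metis
  show thesis
  proof
    show L_le: "norm (L q) \<le> norm q" for q
      by (rule tendsto_upperbound[OF tendsto_norm[OF L]]) (simp_all add: le)
    show "bounded_clinear L"
    proof (rule bounded_clinearI[where K = 1])
      show "L (x + y) = L x + L y" for x y
        by (rule LIMSEQ_unique[OF L]) (simp add: bounded_clinear_add[OF lin] tendsto_add L)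
      show "L (c *\<^sub>C x) = c *\<^sub>C L x" for c x
      proof -
        from bounded_linear.tendsto[OF bounded_linear_scaleC_right L]
        show ?thesis by (intro LIMSEQ_unique[OF L]) (simp add: bounded_clinear_scaleC[OF lin])
      qed
    qed (use L_le in simp)
    show "L (creation i q) = creation i (L q)" if "creation i q \<in> poly_space k" for i q
    \<comment> \<open>Stage \<open>Suc m\<close> on the shifted vector matches the shift of stage
      \<open>m\<close>; this index offset disappears in the limit.\<close>
    proof (rule LIMSEQ_unique[OF LIMSEQ_Suc[OF L]])
      show "(\<lambda>m. B (Suc m) (creation i q)) \<longlonglongrightarrow> creation i (L q)"
        unfolding BS[OF that] by (intro bounded_linear.tendsto[OF bounded_linear_creation] L)
    qed
    show "L q - B\<^sub>0 q \<in> ortho_compl (ortho_compl G)" for q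
    proof (rule closed_sequentially[OF closed_ortho_compl])
      show "B m q - B\<^sub>0 q \<in> ortho_compl (ortho_compl G)" for m
        using BmN[of 0 m q] by (simp add: N_def Gs B)
      show "(\<lambda>m. B m q - B\<^sub>0 q) \<longlonglongrightarrow> L q - B\<^sub>0 q" by (intro tendsto_intros L)
    qed
  qed
qed

section \<open>Multiplication operators and truncation\<close>

lemma mult_op_scaleC:
  assumes "bounded_clinear \<phi>" "q \<in> poly_space k"
  shows "mult_op \<phi> (c *\<^sub>C q) = c *\<^sub>C mult_op \<phi> q"
proof -
  from has_sum_bounded_linear[OF bounded_linear_scaleC_right has_sum_infsum[OF mult_op_summable[OF assms]]]
  show ?thesis
    unfolding mult_op_def
    by (intro infsumI) (simp add: scaleC_fock.rep_eq bounded_clinear_scaleC[OF assms(1)]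
        bounded_clinear_scaleC[OF bounded_clinear_creation_word])
qed

lemma mult_op_diff:
  assumes "bounded_clinear \<phi>" "bounded_clinear \<phi>'" "q \<in> poly_space k"
  shows "mult_op (\<lambda>h. \<phi> h - \<phi>' h) q = mult_op \<phi> q - mult_op \<phi>' q"
proof -
  have "((\<lambda>\<alpha>. creation_word \<alpha> (\<phi> (coeff q \<alpha>)) + - creation_word \<alpha> (\<phi>' (coeff q \<alpha>)))
      has_sum mult_op \<phi> q + - mult_op \<phi>' q) UNIV"
    unfolding mult_op_def
    by (intro has_sum_add has_sum_uminus[THEN iffD2] has_sum_infsum mult_op_summable[OF assms(1,3)])
       (simp add: has_sum_infsum mult_op_summable[OF assms(2,3)])
  from infsumI[OF this] show ?thesis
    by (simp add: mult_op_def[of "\<lambda>h. \<phi> h - \<phi>' h"] bounded_clinear_diff[OF bounded_clinear_creation_word])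
qed

text \<open>\<open>M\<close> commutes with every \<open>creation_word\<close> and, being continuous,
  passes through the series.\<close>

lemma mult_op_compose:
  assumes "bounded_clinear \<psi>" "multi_analytic M" "q \<in> poly_space k"
  shows "M (mult_op \<psi> q) = mult_op (\<lambda>h. M (\<psi> h)) q"
proof -
  have M: "bounded_linear M" "\<And>i f. M (creation i f) = creation i (M f)"
    using assms(2) by (auto simp: multi_analytic_def bounded_clinear_def)
  have "M (creation_word \<alpha> g) = creation_word \<alpha> (M g)" for \<alpha> g
    by (induction \<alpha>) (simp_all add: creation_word_Cons M)
  then show ?thesis
    unfolding mult_op_def
    using infsumI[OF has_sum_bounded_linear[OF M(1) has_sum_infsum[OF mult_op_summable[OF assms(1,3)]]]]
    by simp
qed

section \<open>Operators commuting with creation inside a polynomial space\<close>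

lemma creation_word_intertwine:
  assumes "\<And>i q. creation i q \<in> poly_space k \<Longrightarrow> L (creation i q) = creation i (L q)"
    and "length \<alpha> \<le> k"
  shows "L (tensor (basis_vec \<alpha>) h) = creation_word \<alpha> (L (tensor (basis_vec []) h))"
  using assms(2)
proof (induction \<alpha>)
  case (Cons i \<alpha>)
  have "creation i (tensor (basis_vec \<alpha>) h) = tensor (basis_vec (i # \<alpha>)) h"
    by (simp add: creation_tensor creation_basis_vec)
  moreover have "tensor (basis_vec (i # \<alpha>)) h \<in> poly_space k"
    using Cons.prems by (auto simp: poly_space_def coeff_tensor_basis_vec)
  ultimately show ?case
    using assms(1)[of i "tensor (basis_vec \<alpha>) h"] Cons by (simp add: creation_word_Cons)
qed simp

lemma tensor_zero_right [simp]: "tensor f 0 = 0"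
  by (rule fock_eqI) (simp add: tensor.rep_eq zero_fock.rep_eq)

text \<open>Continuity and the basis expansion of \<open>q\<close> reduce the claim to single words,
  where the values on constants determine \<open>L\<close>.\<close>

lemma intertwiner_eq_mult_op:
  assumes "bounded_clinear L"
    and "\<And>i q. creation i q \<in> poly_space k \<Longrightarrow> L (creation i q) = creation i (L q)"
    and "q \<in> poly_space k"
  shows "L q = mult_op (\<lambda>h. L (tensor (basis_vec []) h)) q"
proof -
  have "L (tensor (basis_vec \<alpha>) (coeff q \<alpha>)) = creation_word \<alpha> (L (tensor (basis_vec []) (coeff q \<alpha>)))"
    for \<alpha>
  proof (cases "length \<alpha> \<le> k")
    case True
    then show ?thesis by (intro creation_word_intertwine[of k L] assms(2))
  next
    case False
    \<comment> \<open>Words longer than \<open>k\<close> have coefficient 0 in \<open>q\<close>, so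
      both sides vanish although no intertwining is available there.\<close>
    then show ?thesis
      using assms(3) by (simp add: poly_space_def bounded_clinear_zero[OF assms(1)])
  qed
  then show ?thesis
    unfolding mult_op_def
    using infsumI[OF has_sum_bounded_linear[OF _ has_sum_tensor_basis_vec[of q], of L]] assms(1)
    by (simp add: bounded_clinear_def)
qed

text \<open>The projection onto the polynomials. Composing with it turns an operator given only on
  polynomials into a total one, the form that \<open>partial_lifting\<close> expects.\<close>

lift_definition truncate :: "nat \<Rightarrow> ('i, 'a::complex_hilbert_space) fock \<Rightarrow> ('i, 'a) fock"
  is "\<lambda>k f \<alpha>. if length \<alpha> \<le> k then f \<alpha> else 0"
proof -
  fix k and f :: "'i list \<Rightarrow> 'a"
  assume "(\<lambda>\<alpha>. (norm (f \<alpha>))\<^sup>2) summable_on UNIV"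
  then show "(\<lambda>\<alpha>. (norm (if length \<alpha> \<le> k then f \<alpha> else 0))\<^sup>2) summable_on UNIV"
    by (rule summable_on_comparison_test) simp_all
qed

lemma truncate_poly_space: "truncate k f \<in> poly_space k"
  by (simp add: poly_space_def truncate.rep_eq)

lemma truncate_id: "f \<in> poly_space k \<Longrightarrow> truncate k f = f"
  by (rule fock_eqI) (simp add: poly_space_def truncate.rep_eq)

lemma truncate_add: "truncate k (f + g) = truncate k f + truncate k g"
  and truncate_scaleC: "truncate k (c *\<^sub>C f) = c *\<^sub>C truncate k f"
  by (rule fock_eqI; simp add: truncate.rep_eq plus_fock.rep_eq scaleC_fock.rep_eq)+

lemma norm_truncate_le: "norm (truncate k f) \<le> norm f"
proof (rule power2_le_imp_le)
  show "(norm (truncate k f))\<^sup>2 \<le> (norm f)\<^sup>2"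
    unfolding norm_fock_sq by (intro infsum_mono summable_coeff) (simp add: truncate.rep_eq)
qed simp

section \<open>Orthogonal projections and inner operators\<close>

lemma ortho_proj_eqI:
  assumes "y \<in> ortho_compl S" "x - y \<in> ortho_compl (ortho_compl S)"
  shows "ortho_proj (ortho_compl S) x = y"
proof -
  let ?y = "ortho_proj (ortho_compl S) x"
  have "?y - y \<in> ortho_compl S" "(x - y) - (x - ?y) \<in> ortho_compl (ortho_compl S)"
    using ortho_proj_ortho_compl[of S x] assms by (blast intro: ortho_compl_diff)+
  then have "cinner (?y - y) (?y - y) = 0" by (auto simp: ortho_compl_def[of "ortho_compl S"])
  then show ?thesis using Re_cinner_self[of "?y - y"] by simp
qed

lemma ortho_proj_add:
  "ortho_proj (ortho_compl S) (x + y) = ortho_proj (ortho_compl S) x + ortho_proj (ortho_compl S) y"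
  and ortho_proj_scaleC:
  "ortho_proj (ortho_compl S) (c *\<^sub>C x) = c *\<^sub>C ortho_proj (ortho_compl S) x"
  and ortho_proj_cong:
  "x - y \<in> ortho_compl (ortho_compl S) \<Longrightarrow> ortho_proj (ortho_compl S) x = ortho_proj (ortho_compl S) y"
  and norm_ortho_proj_le: "norm (ortho_proj (ortho_compl S) x) \<le> norm x"
proof -
  let ?P = "ortho_proj (ortho_compl S)" and ?N = "ortho_compl (ortho_compl S)"
  have P: "?P z \<in> ortho_compl S" and N: "z - ?P z \<in> ?N" for z
    using ortho_proj_ortho_compl[of S z] by blast+
  have "x + y - (?P x + ?P y) = (x - ?P x) + (y - ?P y)" by simp
  then show "?P (x + y) = ?P x + ?P y"
    by (intro ortho_proj_eqI) (simp_all only: P N ortho_compl_add)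
  show "?P (c *\<^sub>C x) = c *\<^sub>C ?P x"
    by (intro ortho_proj_eqI) (simp_all add: P N ortho_compl_scaleC flip: scaleC_diff_right)
  show "?P x = ?P y" if "x - y \<in> ?N"
  proof (rule ortho_proj_eqI[OF P])
    have "x - ?P y = (x - y) + (y - ?P y)" by simp
    then show "x - ?P y \<in> ?N" using that N by (simp only: ortho_compl_add)
  qed
  have "(norm (?P x))\<^sup>2 \<le> (norm x)\<^sup>2"
    using norm_add_sq[of "?P x" "x - ?P x"] ortho_compl_sym[OF N P, of x x] by simp
  then show "norm (?P x) \<le> norm x" by (rule power2_le_imp_le) simp
qed

text \<open>An isometry maps a complete space onto a complete, hence closed, subspace, to which the
  projection theorem applies. Consequently any vector orthogonal to the complement of the range can
  be factored through \<open>M\<close>.\<close>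

lemma ortho_compl_ortho_compl_range:
  assumes "bounded_clinear M" "\<And>f. norm (M f) = norm f"
  shows "ortho_compl (ortho_compl (range M)) = range M"
proof
  show "range M \<subseteq> ortho_compl (ortho_compl (range M))" by (rule subset_ortho_compl2)
  have "closed (range M)"
    using assms by (intro complete_imp_closed complete_isometric_image[of 1])
      (auto simp: bounded_clinear_def complete_UNIV)
  moreover have "0 \<in> range M" using bounded_clinear_zero[OF assms(1)] by (metis rangeI)
  moreover have "x + y \<in> range M" if "x \<in> range M" "y \<in> range M" for x y
    using that by (auto simp flip: bounded_clinear_add[OF assms(1)])
  moreover have "c *\<^sub>C x \<in> range M" if "x \<in> range M" for c x
    using that by (auto simp flip: bounded_clinear_scaleC[OF assms(1)])
  ultimately have ex: "\<exists>!y. y \<in> range M \<and> x - y \<in> ortho_compl (range M)" for x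
    by (intro ortho_proj_ex1)
  show "ortho_compl (ortho_compl (range M)) \<subseteq> range M"
  proof
    fix x assume x: "x \<in> ortho_compl (ortho_compl (range M))"
    obtain y where y: "y \<in> range M" "x - y \<in> ortho_compl (range M)" using ex by blast
    then have "x - y \<in> ortho_compl (ortho_compl (range M))"
      using x subset_ortho_compl2[of "range M"] by (blast intro: ortho_compl_diff)
    with y(2) have "cinner (x - y) (x - y) = 0"
      by (auto simp: ortho_compl_def[of "ortho_compl (range M)"])
    then show "x \<in> range M" using y Re_cinner_self[of "x - y"] by simp
  qed
qed

lemma poly_norm_le_1_iff:
  assumes "\<And>c q. q \<in> poly_space k \<Longrightarrow> R (c *\<^sub>C q) = c *\<^sub>C R q"
  shows "poly_norm k R \<le> 1 \<longleftrightarrow> (\<forall>q\<in>poly_space k. norm (R q) \<le> norm q)"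
proof
  assume le: "poly_norm k R \<le> 1"
  show "\<forall>q\<in>poly_space k. norm (R q) \<le> norm q"
  proof
    fix q :: "('a, 'b) fock" assume q: "q \<in> poly_space k"
    show "norm (R q) \<le> norm q"
    proof (cases "q = 0")
      case True
      \<comment> \<open>The zero vector cannot be normalized; homogeneity with scalar 0 gives
        \<open>R 0 = 0\<close>.\<close>
      then show ?thesis using assms[OF q, of 0] by simp
    next
      case False
      define c where "c = complex_of_real (inverse (norm q))"
      have c: "cmod c = inverse (norm q)" unfolding c_def norm_of_real by simp
      then have "norm (c *\<^sub>C q) = 1" using False by (simp add: norm_scaleC)
      then have "ereal (norm (R (c *\<^sub>C q))) \<le> poly_norm k R"
        unfolding poly_norm_def using q by (intro SUP_upper) (auto intro: poly_space_scaleC)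
      with le have "ereal (norm (R (c *\<^sub>C q))) \<le> 1" using order_trans by blast
      then show ?thesis
        using False by (simp add: assms[OF q] norm_scaleC c field_simps flip: one_ereal_def)
    qed
  qed
next
  assume "\<forall>q\<in>poly_space k. norm (R q) \<le> norm q"
  then show "poly_norm k R \<le> 1"
    unfolding poly_norm_def by (intro SUP_least) (force simp: one_ereal_def)
qed

section \<open>The two directions of the equivalence\<close>

theorem theorem3p2:
  fixes k :: nat
    and \<phi> :: "'k::complex_hilbert_space \<Rightarrow> ('i::countable, 'l::complex_hilbert_space) fock"
    and M\<^sub>\<theta> :: "('i, 'e::complex_hilbert_space) fock \<Rightarrow> ('i, 'l) fock"
  assumes "bounded_clinear \<phi>"
    and "inner_multi_analytic M\<^sub>\<theta>"
  shows "(\<exists>\<psi> :: 'k \<Rightarrow> ('i, 'e) fock. bounded_clinear \<psi> \<and>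
            poly_norm k (\<lambda>q. mult_op \<phi> q - M\<^sub>\<theta> (mult_op \<psi> q)) \<le> 1)
      \<longleftrightarrow> contraction_on (poly_space k)
            (\<lambda>q. ortho_proj (ortho_compl (range M\<^sub>\<theta>)) (mult_op \<phi> q))"
proof -
  let ?H = "ortho_compl (range M\<^sub>\<theta>)"
  have ma: "multi_analytic M\<^sub>\<theta>" and iso: "\<And>f. norm (M\<^sub>\<theta> f) = norm f"
    using assms(2) by (auto simp: inner_multi_analytic_def)
  then have M: "bounded_clinear M\<^sub>\<theta>" "\<And>i f. M\<^sub>\<theta> (creation i f) = creation i (M\<^sub>\<theta> f)"
    by (auto simp: multi_analytic_def)
  have N: "ortho_compl ?H = range M\<^sub>\<theta>" using ortho_compl_ortho_compl_range[OF M(1) iso] .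
  have norm_iff: "poly_norm k (\<lambda>q. mult_op \<phi> q - M\<^sub>\<theta> (mult_op \<psi> q)) \<le> 1 \<longleftrightarrow>
      (\<forall>q\<in>poly_space k. norm (mult_op \<phi> q - M\<^sub>\<theta> (mult_op \<psi> q)) \<le> norm q)"
    if "bounded_clinear \<psi>" for \<psi> :: "'k \<Rightarrow> ('i, 'e) fock"
    by (rule poly_norm_le_1_iff)
      (use that assms(1) in \<open>simp add: mult_op_scaleC bounded_clinear_scaleC[OF M(1)] scaleC_diff_right\<close>)
  show ?thesis
  proof
    assume "\<exists>\<psi> :: 'k \<Rightarrow> ('i, 'e) fock. bounded_clinear \<psi> \<and>
        poly_norm k (\<lambda>q. mult_op \<phi> q - M\<^sub>\<theta> (mult_op \<psi> q)) \<le> 1"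
    then obtain \<psi> :: "'k \<Rightarrow> ('i, 'e) fock" where
      le: "\<And>q. q \<in> poly_space k \<Longrightarrow> norm (mult_op \<phi> q - M\<^sub>\<theta> (mult_op \<psi> q)) \<le> norm q"
      using norm_iff by blast
    \<comment> \<open>The projection annihilates the range of \<open>M\<^sub>\<theta>\<close>, so
      the correction by \<open>\<psi>\<close> leaves the compressed operator unchanged.\<close>
    have eq: "ortho_proj ?H (mult_op \<phi> q) = ortho_proj ?H (mult_op \<phi> q - M\<^sub>\<theta> (mult_op \<psi> q))" for q
      by (rule ortho_proj_cong) (simp add: N)
    then show "contraction_on (poly_space k) (\<lambda>q. ortho_proj ?H (mult_op \<phi> q))"
      unfolding contraction_on_def eq by (blast intro: order_trans[OF norm_ortho_proj_le le])
  next
    assume "contraction_on (poly_space k) (\<lambda>q. ortho_proj ?H (mult_op \<phi> q))"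
    then have contr: "norm (ortho_proj ?H (mult_op \<phi> q)) \<le> norm q" if "q \<in> poly_space k" for q
      using that by (simp add: contraction_on_def)
    have inv: "creation i y \<in> ortho_compl ?H" if "y \<in> ortho_compl ?H" for i y
      using that unfolding N by (auto simp flip: M(2))
    define B\<^sub>0 where "B\<^sub>0 q = ortho_proj ?H (mult_op \<phi> (truncate k q))" for q
    have B\<^sub>0_le: "norm (B\<^sub>0 q) \<le> norm q" for q
      unfolding B\<^sub>0_def by (rule order_trans[OF contr[OF truncate_poly_space] norm_truncate_le])
    have "bounded_clinear B\<^sub>0"
    proof (rule bounded_clinearI[where K = 1])
      show "B\<^sub>0 (x + y) = B\<^sub>0 x + B\<^sub>0 y" for x y
        by (simp add: B\<^sub>0_def truncate_add ortho_proj_add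
            mult_op_add[OF assms(1) truncate_poly_space truncate_poly_space])
      show "B\<^sub>0 (c *\<^sub>C x) = c *\<^sub>C B\<^sub>0 x" for c x
        by (simp add: B\<^sub>0_def truncate_scaleC ortho_proj_scaleC
            mult_op_scaleC[OF assms(1) truncate_poly_space])
    qed (use B\<^sub>0_le in simp)
    moreover have "B\<^sub>0 q \<in> ?H" for q
      unfolding B\<^sub>0_def using ortho_proj_ortho_compl by blast
    moreover have "creation i (B\<^sub>0 q) - B\<^sub>0 (creation i q) \<in> ortho_compl ?H"
      if Sq: "creation i q \<in> poly_space k" for i q
    proof -
      let ?m = "mult_op \<phi> q"
      have "q \<in> poly_space k" using Sq by (rule creation_poly_spaceD)
      \<comment> \<open>The first bracket is a projection residual and the second term is a shifted
        residual; both lie in the shift-invariant complement of \<open>?H\<close>.\<close>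
      then have "creation i (B\<^sub>0 q) - B\<^sub>0 (creation i q)
          = (creation i ?m - ortho_proj ?H (creation i ?m)) - creation i (?m - ortho_proj ?H ?m)"
        using Sq by (simp add: B\<^sub>0_def truncate_id mult_op_creation[OF assms(1)]
            bounded_clinear_diff[OF bounded_clinear_creation])
      then show ?thesis
        using ortho_proj_ortho_compl[of "range M\<^sub>\<theta>"] inv by (simp only: ortho_compl_diff)
    qed
    ultimately have "partial_lifting k (range M\<^sub>\<theta>) B\<^sub>0" by (simp add: partial_lifting_def B\<^sub>0_le)
    from lifting[OF inv this] obtain L where L: "bounded_clinear L" "\<And>q. norm (L q) \<le> norm q"
      "\<And>i q. creation i q \<in> poly_space k \<Longrightarrow> L (creation i q) = creation i (L q)"
      "\<And>q. L q - B\<^sub>0 q \<in> ortho_compl ?H" by blast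
    \<comment> \<open>On polynomials of degree at most \<open>k\<close> the operator
      \<open>L\<close> is determined by its values on constants, which serve as its symbol.\<close>
    define \<phi>' where "\<phi>' h = L (tensor (basis_vec []) h)" for h
    have \<phi>'_le: "norm (\<phi>' h) \<le> norm h" for h
      using L(2)[of "tensor (basis_vec []) h"] by (simp add: \<phi>'_def norm_tensor_basis_vec)
    have \<phi>': "bounded_clinear \<phi>'"
    proof (rule bounded_clinearI[where K = 1])
      have "tensor (basis_vec []) (x + y) = tensor (basis_vec []) x + (tensor (basis_vec []) y :: ('i, 'k) fock)" for x y
        by (rule fock_eqI) (simp add: coeff_tensor_basis_vec plus_fock.rep_eq)
      then show "\<phi>' (x + y) = \<phi>' x + \<phi>' y" for x y by (simp add: \<phi>'_def bounded_clinear_add[OF L(1)])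
      have "tensor (basis_vec []) (c *\<^sub>C x) = c *\<^sub>C (tensor (basis_vec []) x :: ('i, 'k) fock)" for c x
        by (rule fock_eqI) (simp add: coeff_tensor_basis_vec scaleC_fock.rep_eq)
      then show "\<phi>' (c *\<^sub>C x) = c *\<^sub>C \<phi>' x" for c x
        by (simp add: \<phi>'_def bounded_clinear_scaleC[OF L(1)])
    qed (use \<phi>'_le in simp)
    have "\<phi> h - \<phi>' h \<in> ortho_compl ?H" for h
    proof -
      let ?q = "tensor (basis_vec []) h :: ('i, 'k) fock"
      \<comment> \<open>On constants \<open>B\<^sub>0\<close> is the projection of
        \<open>\<phi> h\<close>, and \<open>L\<close> differs from it by a vector orthogonal to
        \<open>?H\<close>.\<close>
      have "?q \<in> poly_space k" by (simp add: poly_space_def coeff_tensor_basis_vec)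
      then have "B\<^sub>0 ?q = ortho_proj ?H (\<phi> h)"
        by (simp add: B\<^sub>0_def truncate_id mult_op_tensor_basis_vec[OF assms(1)])
      then have "\<phi> h - \<phi>' h = (\<phi> h - ortho_proj ?H (\<phi> h)) - (L ?q - B\<^sub>0 ?q)"
        by (simp add: \<phi>'_def)
      then show ?thesis
        using ortho_proj_ortho_compl[of "range M\<^sub>\<theta>" "\<phi> h"] L(4) by (simp only: ortho_compl_diff)
    qed
    \<comment> \<open>The difference of the symbols is pulled back through
      \<open>M\<^sub>\<theta>\<close>. Injectivity of the isometry transfers linearity to
      \<open>\<psi>\<close>, and equality of norms transfers the bound.\<close>
    then have "\<forall>h. \<exists>f. M\<^sub>\<theta> f = \<phi> h - \<phi>' h" unfolding N by (metis imageE)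
    then obtain \<psi> where \<psi>: "\<And>h. M\<^sub>\<theta> (\<psi> h) = \<phi> h - \<phi>' h" by metis
    have inj: "f = g" if "M\<^sub>\<theta> f = M\<^sub>\<theta> g" for f g
      using iso[of "f - g"] that by (simp add: bounded_clinear_diff[OF M(1)])
    obtain K where K: "\<And>h. norm (\<phi> h) \<le> norm h * K"
      using assms(1) bounded_linear.bounded[of \<phi>] unfolding bounded_clinear_def by blast
    have "bounded_clinear \<psi>"
    proof (rule bounded_clinearI[where K = "K + 1"])
      show "\<psi> (x + y) = \<psi> x + \<psi> y" for x y
        by (rule inj) (simp add: \<psi> bounded_clinear_add[OF M(1)] bounded_clinear_add[OF assms(1)]
            bounded_clinear_add[OF \<phi>'])
      show "\<psi> (c *\<^sub>C x) = c *\<^sub>C \<psi> x" for c x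
        by (rule inj) (simp add: \<psi> bounded_clinear_scaleC[OF M(1)] bounded_clinear_scaleC[OF assms(1)]
            bounded_clinear_scaleC[OF \<phi>'] scaleC_diff_right)
      show "norm (\<psi> h) \<le> norm h * (K + 1)" for h
      proof -
        have "norm (\<psi> h) = norm (\<phi> h - \<phi>' h)" by (metis iso \<psi>)
        then show ?thesis
          using norm_triangle_ineq4[of "\<phi> h" "\<phi>' h"] K[of h] \<phi>'_le[of h] by (simp add: algebra_simps)
      qed
    qed
    moreover have "norm (mult_op \<phi> q - M\<^sub>\<theta> (mult_op \<psi> q)) \<le> norm q" if "q \<in> poly_space k" for q
    proof -
      \<comment> \<open>On \<open>poly_space k\<close> the remainder is the multiplication operator
        of \<open>\<phi>'\<close>, that is, the contraction \<open>L\<close>.\<close>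
      have "M\<^sub>\<theta> (mult_op \<psi> q) = mult_op \<phi> q - mult_op \<phi>' q"
        using mult_op_compose[OF calculation ma that] mult_op_diff[OF assms(1) \<phi>' that] by (simp add: \<psi>)
      moreover have "mult_op \<phi>' q = L q"
        using intertwiner_eq_mult_op[OF L(1,3) that] by (simp add: \<phi>'_def[abs_def])
      ultimately show ?thesis using L(2) by simp
    qed
    ultimately show "\<exists>\<psi> :: 'k \<Rightarrow> ('i, 'e) fock. bounded_clinear \<psi> \<and>
        poly_norm k (\<lambda>q. mult_op \<phi> q - M\<^sub>\<theta> (mult_op \<psi> q)) \<le> 1"
      using norm_iff by blast
  qed
qed

end
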